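(* Let $f$ satisfy (f1) and suppose $f_0\in(0,+\infty)$ and $f_\infty=+\infty$. Then for every $\lambda\in(0,\lambda_1/f_0)$, problem (MO) has two solutions $u^+$ and $u^-$ such that $u^+$ is positive and strictly concave in $(0,1)$ and $u^-$ is negative and strictly convex in $(0,1)$.
   Context: Let $N\ge 1$ be an integer and $f:\mathbb{R}\to\mathbb{R}$ continuous. For $\lambda\ge 0$, problem (MO) is: find $u\in C^2[0,1]$ with $\left((u'(r))^N\right)'=\lambda^N N r^{N-1} f(-u(r))$ for $0<r<1$ and $u'(0)=u(1)=0$. Condition (f1): $f\in C(\mathbb{R},\mathbb{R})$ and $f(s)s^N>0$ for all $s\neq0$. The quantities $f_0,f_\infty\in[0,+\infty]$ are defined by $f_0^N=\lim_{s\to0} f(s)/s^N$ and $f_\infty^N=\lim_{|s|\to+\infty} f(s)/s^N$ (limits assumed to exist in $[0,+\infty]$). $\lambda_1>0$ denotes the first eigenvalue of $\left((-v')^N\right)'=\lambda^N N r^{N-1}v^N$ in $(0,1)$, $v'(0)=v(1)=0$, i.e. the unique $\lambda>0$ for which this problem has a solution $v\in C^2[0,1]$ positive in $(0,1)$. *)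

theory Defs
  imports "HOL-Analysis.Analysis"
begin

definition strictly_convex_on :: "real set \<Rightarrow> (real \<Rightarrow> real) \<Rightarrow> bool" where
  "strictly_convex_on S u \<longleftrightarrow>
     (\<forall>x\<in>S. \<forall>y\<in>S. \<forall>t::real. x \<noteq> y \<and> 0 < t \<and> t < 1 \<longrightarrow>
        u ((1 - t) * x + t * y) < (1 - t) * u x + t * u y)"

definition strictly_concave_on :: "real set \<Rightarrow> (real \<Rightarrow> real) \<Rightarrow> bool" where
  "strictly_concave_on S u \<longleftrightarrow>
     (\<forall>x\<in>S. \<forall>y\<in>S. \<forall>t::real. x \<noteq> y \<and> 0 < t \<and> t < 1 \<longrightarrow>
        u ((1 - t) * x + t * y) > (1 - t) * u x + t * u y)"

definition C2_01 :: "(real \<Rightarrow> real) \<Rightarrow> (real \<Rightarrow> real) \<Rightarrow> (real \<Rightarrow> real) \<Rightarrow> bool" where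
  "C2_01 u u' u'' \<longleftrightarrow>
     (\<forall>r\<in>{0..1}. (u has_real_derivative u' r) (at r within {0..1}) \<and>
                 (u' has_real_derivative u'' r) (at r within {0..1})) \<and>
     continuous_on {0..1} u''"

definition MO_solution :: "nat \<Rightarrow> (real \<Rightarrow> real) \<Rightarrow> real \<Rightarrow> (real \<Rightarrow> real) \<Rightarrow> bool" where
  "MO_solution N f lam u \<longleftrightarrow>
     (\<exists>u' u''. C2_01 u u' u'' \<and>
        (\<forall>r\<in>{0<..<1}. ((\<lambda>s. (u' s) ^ N) has_real_derivative
              lam ^ N * real N * r ^ (N - 1) * f (- u r)) (at r)) \<and>
        u' 0 = 0 \<and> u 1 = 0)"

definition has_positive_eigenfunction :: "nat \<Rightarrow> real \<Rightarrow> bool" where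
  "has_positive_eigenfunction N lam \<longleftrightarrow>
     (\<exists>v v' v''. C2_01 v v' v'' \<and>
        (\<forall>r\<in>{0<..<1}. ((\<lambda>s. (- v' s) ^ N) has_real_derivative
              lam ^ N * real N * r ^ (N - 1) * (v r) ^ N) (at r)) \<and>
        v' 0 = 0 \<and> v 1 = 0 \<and> (\<forall>r\<in>{0<..<1}. v r > 0))"

definition first_eigenvalue :: "nat \<Rightarrow> real" where
  "first_eigenvalue N = (THE lam. lam > 0 \<and> has_positive_eigenfunction N lam)"

end

theory Submission
  imports Defs "HOL-Complex_Analysis.Great_Picard"
begin

text \<open>
  Both solutions come from a positive profile \<open>v\<close> with \<open>((- v')^N)' = N r^(N-1) G v\<close>, where
  \<open>G s = lam^N * f s\<close> gives the negative solution \<open>- v\<close> and \<open>G s = lam^N * (-1)^N * f (- s)\<close> gives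
  the positive solution \<open>v\<close>. The profile is found by shooting from \<open>v 0 = d\<close>. As \<open>f\<close> is merely
  continuous, initial value problems may have several solutions, so the intermediate value theorem is
  applied to the delayed (Tonelli) equation, whose solution depends continuously on \<open>d\<close>; the delay
  is then removed by Arzela--Ascoli.

  For large \<open>d\<close> superlinearity at infinity forces \<open>v 1 < 0\<close>, because a concave \<open>v\<close> with
  \<open>v 1 \<ge> 0\<close> stays above \<open>d (1 - r)\<close>. For small \<open>d\<close> one has \<open>v 1 > 0\<close>: the inverse operator \<open>T\<close>
  is monotone and homogeneous of degree one, so \<open>w \<le> mu T w\<close> and \<open>phi = lam T phi\<close> with \<open>mu < lam\<close>
  give \<open>w \<le> (mu / lam)^n C phi\<close> for all \<open>n\<close>, whence \<open>w \<le> 0\<close>. The same comparison shows that the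
  eigenvalue with a positive eigenfunction is unique, and shooting in \<open>lam\<close> shows that it exists.
\<close>

section \<open>Means, fluxes and their primitives\<close>

text \<open>
  With \<open>I s = integral {0..s} (N t^(N-1) h t)\<close> one has \<open>I s = s^N * radial_mean N h s\<close>, so
  \<open>flux N h s\<close> is the N-th root of \<open>I s\<close> and \<open>descent N h\<close> is the primitive of the flux. Rescaling
  to the fixed interval \<open>{0..1}\<close> gives joint continuity in parameters and removes the
  singularity of the root at \<open>s = 0\<close>.
\<close>

definition radial_mean :: "nat \<Rightarrow> (real \<Rightarrow> real) \<Rightarrow> real \<Rightarrow> real" where
  "radial_mean N h s = integral {0..1} (\<lambda>t. real N * t ^ (N - 1) * h (s * t))"

definition flux :: "nat \<Rightarrow> (real \<Rightarrow> real) \<Rightarrow> real \<Rightarrow> real" where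
  "flux N h s = s * root N (radial_mean N h s)"

definition descent :: "nat \<Rightarrow> (real \<Rightarrow> real) \<Rightarrow> real \<Rightarrow> real" where
  "descent N h r = integral {0..1} (\<lambda>t. r * flux N h (r * t))"

lemma integral_rescale_unit:
  fixes k :: "real \<Rightarrow> real"
  assumes "0 \<le> s"
  shows "integral {0..1} (\<lambda>t. s * k (s * t)) = integral {0..s} k"
proof (cases "s = 0")
  case False
  then have im: "(\<lambda>x. x / s) ` {0..s} = {0..1}"
    using assms by (auto simp: image_iff field_simps intro!: bexI[of _ "s * _"])
  have "integral {0..1} (\<lambda>t. k (s * t)) = (1 / s) * integral {0..s} k"
    using integral_stretch_real[of s 0 s k] False assms by (simp add: im)
  then show ?thesis using False by simp
qed simp

lemma mult_in_unit: "s \<in> {0..1} \<Longrightarrow> t \<in> {0..1} \<Longrightarrow> s * t \<in> {0..1::real}"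
  by (auto simp: mult_le_one)

section \<open>Continuity of mean, flux and descent, jointly in a parameter and the radius\<close>

lemma continuous_on_rescale_param:
  fixes H :: "'p::topological_space \<Rightarrow> real \<Rightarrow> real"
  assumes "continuous_on (A \<times> {0..1}) (\<lambda>(p, s). H p s)"
  shows "continuous_on ((A \<times> {0..1}) \<times> {0..1}) (\<lambda>(x, t). H (fst x) (snd x * t))"
proof -
  have "continuous_on ((A \<times> {0..1}) \<times> {0..1})
      (\<lambda>y. (\<lambda>(p, s). H p s) (fst (fst y), snd (fst y) * snd y))"
    by (intro continuous_on_compose2[OF assms] continuous_intros)
      (auto simp: mult_le_one)
  then show ?thesis by (simp add: case_prod_unfold)
qed

lemma continuous_on_radial_mean_param:
  fixes H :: "'p::topological_space \<Rightarrow> real \<Rightarrow> real"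
  assumes "continuous_on (A \<times> {0..1}) (\<lambda>(p, s). H p s)"
  shows "continuous_on (A \<times> {0..1}) (\<lambda>(p, s). radial_mean N (H p) s)"
proof -
  have "continuous_on ((A \<times> {0..1}) \<times> cbox 0 1)
      (\<lambda>(x, t::real). real N * t ^ (N - 1) * H (fst x) (snd x * t))"
    using continuous_on_rescale_param[OF assms]
    by (auto simp: case_prod_unfold intro!: continuous_intros)
  from integral_continuous_on_param[OF this] show ?thesis
    by (simp add: radial_mean_def case_prod_unfold)
qed

lemma continuous_on_flux_param:
  fixes H :: "'p::topological_space \<Rightarrow> real \<Rightarrow> real"
  assumes "continuous_on (A \<times> {0..1}) (\<lambda>(p, s). H p s)"
  shows "continuous_on (A \<times> {0..1}) (\<lambda>(p, s). flux N (H p) s)"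
  using continuous_on_radial_mean_param[OF assms, of N]
  by (auto simp: flux_def case_prod_unfold intro!: continuous_intros)

lemma continuous_on_descent_param:
  fixes H :: "'p::topological_space \<Rightarrow> real \<Rightarrow> real"
  assumes "continuous_on (A \<times> {0..1}) (\<lambda>(p, s). H p s)"
  shows "continuous_on (A \<times> {0..1}) (\<lambda>(p, s). descent N (H p) s)"
proof -
  have "continuous_on ((A \<times> {0..1}) \<times> cbox 0 1)
      (\<lambda>(x, t::real). snd x * flux N (H (fst x)) (snd x * t))"
    using continuous_on_rescale_param[OF continuous_on_flux_param[OF assms]]
    by (auto simp: case_prod_unfold intro!: continuous_intros)
  from integral_continuous_on_param[OF this] show ?thesis
    by (simp add: descent_def case_prod_unfold)
qed

text \<open>A dummy real parameter makes the parameter-free continuity facts instances of the joint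
  ones.\<close>

lemma continuous_on_const_param:
  fixes h :: "real \<Rightarrow> real"
  assumes "continuous_on {0..1} h"
  shows "continuous_on (UNIV \<times> {0..1}) (\<lambda>(p::real, s). h s)"
  unfolding case_prod_unfold
  by (intro continuous_on_compose2[OF assms] continuous_intros) auto

lemma continuous_on_slice:
  fixes F :: "'p::topological_space \<Rightarrow> real \<Rightarrow> real"
  assumes "continuous_on (A \<times> S) (\<lambda>(p, s). F p s)" "p \<in> A"
  shows "continuous_on S (F p)"
proof -
  have "continuous_on S (\<lambda>s. (\<lambda>(p, s). F p s) (p, s))"
    using assms(2) by (intro continuous_on_compose2[OF assms(1)] continuous_intros) auto
  then show ?thesis by simp
qed

lemma continuous_on_radial_mean:
  "continuous_on {0..1} h \<Longrightarrow> continuous_on {0..1} (radial_mean N h)"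
  using continuous_on_slice[OF continuous_on_radial_mean_param[OF continuous_on_const_param]] by auto

lemma continuous_on_flux:
  "continuous_on {0..1} h \<Longrightarrow> continuous_on {0..1} (flux N h)"
  using continuous_on_slice[OF continuous_on_flux_param[OF continuous_on_const_param]] by auto

lemma continuous_on_descent:
  "continuous_on {0..1} h \<Longrightarrow> continuous_on {0..1} (descent N h)"
  using continuous_on_slice[OF continuous_on_descent_param[OF continuous_on_const_param]] by auto

section \<open>Order, scaling and positivity properties of mean and flux\<close>

lemma continuous_on_radial_integrand:
  assumes "continuous_on {0..1} h" "s \<in> {0..1}"
  shows "continuous_on {0..1} (\<lambda>t. real N * t ^ (N - 1) * h (s * t))"
  using assms(2)
  by (intro continuous_intros continuous_on_compose2[OF assms(1)]) (auto simp: mult_le_one)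

lemma power_mult_radial_mean:
  assumes "N \<ge> 1" "0 \<le> s"
  shows "s ^ N * radial_mean N h s = integral {0..s} (\<lambda>t. real N * t ^ (N - 1) * h t)"
proof -
  have p: "s ^ N = s * s ^ (N - 1)"
    using assms(1) by (metis Suc_pred' power_Suc less_eq_Suc_le One_nat_def)
  have "s ^ N * radial_mean N h s
      = integral {0..1} (\<lambda>t. s ^ N * (real N * t ^ (N - 1) * h (s * t)))"
    by (simp add: radial_mean_def)
  also have "\<dots> = integral {0..1} (\<lambda>t. s * (\<lambda>t. real N * t ^ (N - 1) * h t) (s * t))"
    by (simp add: p power_mult_distrib mult_ac)
  also have "\<dots> = integral {0..s} (\<lambda>t. real N * t ^ (N - 1) * h t)"
    by (rule integral_rescale_unit[OF assms(2)])
  finally show ?thesis .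
qed

text \<open>Unit mass of the weight makes \<open>radial_mean\<close> a genuine average: it fixes
  constants, so pointwise bounds on \<open>h\<close> pass to its means.\<close>

lemma has_integral_radial_weight:
  assumes "N \<ge> 1"
  shows "((\<lambda>t::real. real N * t ^ (N - 1)) has_integral 1) {0..1}"
proof -
  have "((\<lambda>t::real. real N * t ^ (N - 1)) has_integral (1 ^ N - 0 ^ N)) {0..1}"
    by (rule fundamental_theorem_of_calculus)
      (auto simp: has_real_derivative_iff_has_vector_derivative[symmetric]
        intro!: derivative_eq_intros)
  then show ?thesis using assms by (simp add: zero_power)
qed

lemma radial_mean_const: "N \<ge> 1 \<Longrightarrow> radial_mean N (\<lambda>_. c) s = c"
  using integral_unique[OF has_integral_mult_left[OF has_integral_radial_weight, of N c]]
  unfolding radial_mean_def by simp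

lemma radial_mean_0: "N \<ge> 1 \<Longrightarrow> radial_mean N h 0 = h 0"
  using radial_mean_const[of N "h 0"] by (simp add: radial_mean_def)

lemma radial_mean_cmult: "radial_mean N (\<lambda>t. c * h t) s = c * radial_mean N h s"
proof -
  have "radial_mean N (\<lambda>t. c * h t) s = integral {0..1} (\<lambda>t. c * (real N * t ^ (N - 1) * h (s * t)))"
    by (simp add: radial_mean_def mult_ac)
  then show ?thesis by (simp add: radial_mean_def)
qed

lemma radial_mean_mono:
  assumes "continuous_on {0..1} h" "continuous_on {0..1} k" "s \<in> {0..1}"
    and "\<And>t. t \<in> {0..s} \<Longrightarrow> h t \<le> k t"
  shows "radial_mean N h s \<le> radial_mean N k s"
  unfolding radial_mean_def
proof (rule integral_le)
  fix t :: real assume t: "t \<in> {0..1}"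
  then have "s * t \<in> {0..s}" using assms(3) by (auto simp: mult_left_le)
  then show "real N * t ^ (N - 1) * h (s * t) \<le> real N * t ^ (N - 1) * k (s * t)"
    using t assms(4) by (intro mult_left_mono) auto
qed (intro integrable_continuous_real continuous_on_radial_integrand assms)+

lemma radial_mean_bounds:
  assumes "N \<ge> 1" "continuous_on {0..1} h" "s \<in> {0..1}"
  shows "(\<And>t. t \<in> {0..s} \<Longrightarrow> h t \<le> c) \<Longrightarrow> radial_mean N h s \<le> c"
    and "(\<And>t. t \<in> {0..s} \<Longrightarrow> c \<le> h t) \<Longrightarrow> c \<le> radial_mean N h s"
  using radial_mean_mono[of h "\<lambda>_. c" s N] radial_mean_mono[of "\<lambda>_. c" h s N] assms
  by (simp_all add: radial_mean_const)

text \<open>A nonnegative continuous integrand with integral zero vanishes identically. Testing it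
  at \<open>t = 1/2\<close> avoids both the zero of the weight at \<open>t = 0\<close> and the
  endpoint \<open>t = 1\<close>; the latter matters at \<open>s = 1\<close>, where the source of a
  profile may vanish.\<close>

lemma radial_mean_pos:
  assumes "N \<ge> 1" "continuous_on {0..1} h" "s \<in> {0..1}"
    and "\<And>t. t \<in> {0..1} \<Longrightarrow> 0 \<le> h t" "0 < h (s / 2)"
  shows "0 < radial_mean N h s"
proof -
  have nn: "0 \<le> real N * t ^ (N - 1) * h (s * t)" if "t \<in> {0..1}" for t
    using that assms(4)[OF mult_in_unit[OF assms(3) that]] by auto
  have "radial_mean N h s \<noteq> 0"
  proof
    assume "radial_mean N h s = 0"
    then have "\<forall>t\<in>{0..1}. real N * t ^ (N - 1) * h (s * t) = 0"
      unfolding radial_mean_def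
      using integral_eq_0_iff[OF continuous_on_radial_integrand[OF assms(2,3)] _ nn] by auto
    from bspec[OF this, of "1/2"] show False using assms(1,5) by simp
  qed
  moreover have "0 \<le> radial_mean N h s"
    using radial_mean_bounds(2)[OF assms(1-3), of 0] assms(3,4) by auto
  ultimately show ?thesis by simp
qed

lemma flux_power:
  assumes "N \<ge> 1" "0 \<le> radial_mean N h s"
  shows "flux N h s ^ N = s ^ N * radial_mean N h s"
  using assms by (simp add: flux_def power_mult_distrib)

lemma flux_nonneg:
  assumes "N \<ge> 1" "continuous_on {0..1} h" "s \<in> {0..1}"
    and "\<And>t. t \<in> {0..1} \<Longrightarrow> 0 \<le> h t"
  shows "0 \<le> flux N h s"
  using radial_mean_bounds(2)[OF assms(1-3), of 0] assms by (auto simp: flux_def)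

text \<open>The mean need not be monotone in the radius, but the N-th power of the flux is the
  integral of a nonnegative function over a growing interval.\<close>

lemma flux_mono_arg:
  assumes "N \<ge> 1" "continuous_on {0..1} h" "\<And>t. t \<in> {0..1} \<Longrightarrow> 0 \<le> h t"
    and "0 \<le> s" "s \<le> s'" "s' \<le> 1"
  shows "flux N h s \<le> flux N h s'"
proof -
  have nn: "0 \<le> radial_mean N h x" if "x \<in> {0..1}" for x
    using radial_mean_bounds(2)[OF assms(1,2) that, of 0] assms(3) that by auto
  have c: "continuous_on {0..1} (\<lambda>t. real N * t ^ (N - 1) * h t)"
    using assms(2) by (intro continuous_intros)
  have "flux N h s ^ N \<le> flux N h s' ^ N"
    using assms
    by (auto simp: flux_power nn power_mult_radial_mean
        intro!: integral_subset_le integrable_continuous_real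
          continuous_on_subset[OF c, unfolded One_nat_def])
  moreover have "0 \<le> flux N h s'"
    using assms by (intro flux_nonneg) auto
  ultimately show ?thesis
    using assms(1) by (metis power_mono_iff power_le_imp_le_base Suc_pred' less_eq_Suc_le One_nat_def)
qed

lemma flux_mono_fun:
  assumes "N \<ge> 1" "continuous_on {0..1} h" "continuous_on {0..1} k" "s \<in> {0..1}"
    and "\<And>t. t \<in> {0..s} \<Longrightarrow> h t \<le> k t"
  shows "flux N h s \<le> flux N k s"
  using radial_mean_mono[OF assms(2-5), of N] assms(1,4)
  by (auto simp: flux_def intro!: mult_left_mono)

text \<open>The root undoes the power \<open>c ^ N\<close>. With source \<open>u ^ N\<close>, the
  flux is therefore homogeneous of degree one in \<open>u\<close>, as a linear operator would
  be.\<close>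

lemma flux_cmult_power:
  assumes "N \<ge> 1" "0 \<le> c"
  shows "flux N (\<lambda>t. c ^ N * h t) s = c * flux N h s"
  using assms by (simp add: flux_def radial_mean_cmult real_root_mult real_root_power_cancel)

lemma flux_const_power:
  assumes "N \<ge> 1" "0 \<le> c"
  shows "flux N (\<lambda>t. c ^ N) s = c * s"
  using assms by (simp add: flux_def radial_mean_const real_root_power_cancel)

section \<open>Elementary properties of the descent\<close>

lemma descent_eq_integral:
  "0 \<le> r \<Longrightarrow> descent N h r = integral {0..r} (flux N h)"
  unfolding descent_def by (rule integral_rescale_unit)

lemma descent_0 [simp]: "descent N h 0 = 0"
  by (simp add: descent_def)

text \<open>Causality: the value at \<open>r\<close> sees the source only on \<open>{0..r}\<close>.
  The delayed equation can therefore be solved step by step.\<close>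

lemma descent_cong:
  assumes "r \<in> {0..1}" "\<And>t. t \<in> {0..r} \<Longrightarrow> h t = k t"
  shows "descent N h r = descent N k r"
proof -
  have "radial_mean N h (r * s) = radial_mean N k (r * s)" if "s \<in> {0..1}" for s
    unfolding radial_mean_def
  proof (rule integral_cong)
    fix t :: real assume t: "t \<in> {0..1}"
    then have "r * s * t \<in> {0..r}"
      using assms(1) mult_in_unit[OF that t] by (auto simp: mult.assoc mult_left_le)
    then show "real N * t ^ (N - 1) * h (r * s * t) = real N * t ^ (N - 1) * k (r * s * t)"
      using assms(2) by simp
  qed
  then show ?thesis
    unfolding descent_def flux_def by (intro integral_cong) auto
qed

lemma descent_diff:
  assumes "continuous_on {0..1} h" "r \<in> {0..1}"
  shows "descent N h 1 - descent N h r = integral {r..1} (flux N h)"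
  using Henstock_Kurzweil_Integration.integral_combine[of 0 r 1 "flux N h"] assms
    integrable_continuous_real[OF continuous_on_flux[OF assms(1)], of N]
  by (simp add: descent_eq_integral)

lemma descent_nonneg:
  assumes "N \<ge> 1" "continuous_on {0..1} h" "\<And>t. t \<in> {0..1} \<Longrightarrow> 0 \<le> h t" "r \<in> {0..1}"
  shows "0 \<le> descent N h r"
  unfolding descent_def
proof (rule integral_nonneg)
  show "(\<lambda>t. r * flux N h (r * t)) integrable_on {0..1}"
    using assms(4) by (intro integrable_continuous_real continuous_intros
        continuous_on_compose2[OF continuous_on_flux[OF assms(2)]]) (auto simp: mult_le_one)
  show "0 \<le> r * flux N h (r * t)" if "t \<in> {0..1}" for t
    using assms flux_nonneg[OF assms(1,2) mult_in_unit[OF assms(4) that]] by auto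
qed

text \<open>The flux increases, so the descent is convex and, vanishing at 0, lies below its chord.
  After rescaling this is the comparison of the flux at \<open>r * t\<close> with the flux at
  \<open>t\<close>.\<close>

lemma descent_le_linear:
  assumes "N \<ge> 1" "continuous_on {0..1} h" "\<And>t. t \<in> {0..1} \<Longrightarrow> 0 \<le> h t" "r \<in> {0..1}"
  shows "descent N h r \<le> r * descent N h 1"
proof -
  have "descent N h r \<le> integral {0..1} (\<lambda>t. r * flux N h t)"
    unfolding descent_def
  proof (rule integral_le)
    show "(\<lambda>t. r * flux N h (r * t)) integrable_on {0..1}"
      using assms(4) by (intro integrable_continuous_real continuous_intros
          continuous_on_compose2[OF continuous_on_flux[OF assms(2)]]) (auto simp: mult_le_one)
    show "(\<lambda>t. r * flux N h t) integrable_on {0..1}"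
      by (intro integrable_continuous_real continuous_intros continuous_on_flux[OF assms(2)])
    show "r * flux N h (r * t) \<le> r * flux N h t" if "t \<in> {0..1}" for t
      using assms that
      by (intro mult_left_mono flux_mono_arg) (auto simp: mult_left_le_one_le)
  qed
  then show ?thesis by (simp add: descent_def)
qed

section \<open>Derivatives up to the endpoints of the unit interval\<close>

lemma has_real_derivative_descent:
  assumes "continuous_on {0..1} h" "r \<in> {0..1}"
  shows "(descent N h has_real_derivative flux N h r) (at r within {0..1})"
  by (rule has_field_derivative_transform_within[OF
        integral_has_real_derivative[OF continuous_on_flux[OF assms(1)] assms(2)], of 1])
    (use assms in \<open>auto simp: descent_eq_integral\<close>)

lemma has_real_derivative_flux_power:
  assumes "N \<ge> 1" "continuous_on {0..1} h" "\<And>t. t \<in> {0..1} \<Longrightarrow> 0 \<le> h t" "r \<in> {0..1}"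
  shows "((\<lambda>s. flux N h s ^ N) has_real_derivative real N * r ^ (N - 1) * h r) (at r within {0..1})"
proof -
  have c: "continuous_on {0..1} (\<lambda>t. real N * t ^ (N - 1) * h t)"
    using assms(2) by (intro continuous_intros)
  have nn: "0 \<le> radial_mean N h x" if "x \<in> {0..1}" for x
    using radial_mean_bounds(2)[OF assms(1,2) that, of 0] assms(3) that by auto
  show ?thesis
    by (rule has_field_derivative_transform_within[OF integral_has_real_derivative[OF c assms(4)], of 1])
      (use assms in \<open>auto simp: power_mult_radial_mean flux_power nn\<close>)
qed

text \<open>For \<open>r > 0\<close> the chain rule applies to the root of the N-th power of the
  flux. At \<open>r = 0\<close> that root is singular, but the difference quotient of the flux is
  exactly the root of the mean, which is continuous. The same formula covers both cases because the
  mean at 0 is \<open>h 0\<close>.\<close>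

lemma has_real_derivative_flux:
  assumes N: "N \<ge> 1" and h: "continuous_on {0..1} h" "\<And>t. t \<in> {0..1} \<Longrightarrow> 0 \<le> h t"
    and pos: "\<And>s. s \<in> {0..1} \<Longrightarrow> 0 < radial_mean N h s" and r: "r \<in> {0..1}"
  shows "(flux N h has_real_derivative h r / root N (radial_mean N h r) ^ (N - 1)) (at r within {0..1})"
proof (cases "r = 0")
  case True
  let ?m = "radial_mean N h"
  have "((\<lambda>s. root N (?m s)) \<longlongrightarrow> root N (?m 0)) (at 0 within {0..1})"
    using continuous_on_radial_mean[OF h(1), of N]
    by (intro tendsto_real_root) (auto simp: continuous_on_def)
  moreover have "\<forall>\<^sub>F s in at 0 within {0..1}. root N (?m s) = (flux N h s - flux N h 0) / (s - 0)"
    by (auto simp: eventually_at_filter flux_def)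
  ultimately have "((\<lambda>s. (flux N h s - flux N h 0) / (s - 0)) \<longlongrightarrow> root N (?m 0)) (at 0 within {0..1})"
    by (rule Lim_transform_eventually)
  moreover have "h 0 / root N (?m 0) ^ (N - 1) = root N (?m 0)"
  proof -
    have "h 0 = root N (?m 0) ^ N"
      using N pos[of 0] by (simp add: radial_mean_0)
    also have "\<dots> = root N (?m 0) * root N (?m 0) ^ (N - 1)"
      using N by (metis Suc_pred' power_Suc less_eq_Suc_le One_nat_def)
    finally show ?thesis using pos[of 0] N by (simp add: field_simps)
  qed
  ultimately show ?thesis using True by (simp add: has_field_derivative_iff)
next
  case False
  then have r0: "0 < r" using r by auto
  let ?m = "radial_mean N h"
  have eq: "flux N h s = root N (flux N h s ^ N)" if "s \<in> {0..1}" for s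
    using N flux_nonneg[OF N h(1) that h(2)] by (simp add: real_root_power_cancel)
  have fp: "0 < flux N h r" using pos[OF r] N r0 by (simp add: flux_def)
  have "((\<lambda>s. root N (flux N h s ^ N)) has_real_derivative
      inverse (real N * root N (flux N h r ^ N) ^ (N - Suc 0)) * (real N * r ^ (N - 1) * h r))
      (at r within {0..1})"
    by (rule DERIV_chain2[OF DERIV_real_root has_real_derivative_flux_power[OF N h r]])
      (use N fp in auto)
  moreover have "inverse (real N * root N (flux N h r ^ N) ^ (N - Suc 0)) * (real N * r ^ (N - 1) * h r)
      = h r / root N (?m r) ^ (N - 1)"
    using N fp r0 by (simp add: real_root_power_cancel) (simp add: flux_def power_mult_distrib field_simps)
  ultimately have "((\<lambda>s. root N (flux N h s ^ N)) has_real_derivative h r / root N (?m r) ^ (N - 1))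
      (at r within {0..1})" by simp
  then show ?thesis
    by (rule has_field_derivative_transform_within[of _ _ _ _ 1]) (use r eq in auto)
qed

section \<open>Shooting for the radial initial value problem\<close>

lemma flux_le_root:
  assumes "N \<ge> 1" "continuous_on {0..1} h" "\<And>t. t \<in> {0..1} \<Longrightarrow> 0 \<le> h t"
    "\<And>t. t \<in> {0..1} \<Longrightarrow> h t \<le> B" "s \<in> {0..1}"
  shows "flux N h s \<le> root N B"
proof -
  have "0 \<le> radial_mean N h s" "radial_mean N h s \<le> B"
    using radial_mean_bounds[OF assms(1,2,5)] assms(3-5) by auto
  then have "0 \<le> root N (radial_mean N h s)" "root N (radial_mean N h s) \<le> root N B"
    using assms(1) by auto
  then show ?thesis
    using assms(5) mult_left_le_one_le[of "root N (radial_mean N h s)" s] by (auto simp: flux_def)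
qed

text \<open>The constant depends on \<open>h\<close> only through the bound \<open>B\<close>; this
  provides the equicontinuity for Arzela-Ascoli.\<close>

lemma descent_lipschitz:
  assumes "N \<ge> 1" "continuous_on {0..1} h" "\<And>t. t \<in> {0..1} \<Longrightarrow> 0 \<le> h t"
    "\<And>t. t \<in> {0..1} \<Longrightarrow> h t \<le> B" "r \<in> {0..1}" "s \<in> {0..1}"
  shows "\<bar>descent N h r - descent N h s\<bar> \<le> root N B * \<bar>r - s\<bar>"
  using field_differentiable_bound[of "{0..1}" "descent N h" "flux N h" "root N B" r s]
    has_real_derivative_descent[OF assms(2)] flux_le_root[OF assms(1-4)]
    flux_nonneg[OF assms(1,2) _ assms(3)] assms(5,6)
  by auto

text \<open>Dominated convergence is used twice: for the mean at each radius, then for the integral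
  of the flux. Pointwise convergence of bounded sources is thus enough.\<close>

lemma tendsto_descent:
  assumes N: "N \<ge> 1" and hn: "\<And>n. continuous_on {0..1} (hn n)" and h: "continuous_on {0..1} h"
    and nn: "\<And>n t. t \<in> {0..1} \<Longrightarrow> 0 \<le> hn n t" and B: "\<And>n t. t \<in> {0..1} \<Longrightarrow> hn n t \<le> B"
    and lim: "\<And>t. t \<in> {0..1} \<Longrightarrow> (\<lambda>n. hn n t) \<longlonglongrightarrow> h t" and r: "r \<in> {0..1}"
  shows "(\<lambda>n. descent N (hn n) r) \<longlonglongrightarrow> descent N h r"
proof -
  have m: "(\<lambda>n. radial_mean N (hn n) s) \<longlonglongrightarrow> radial_mean N h s" if s: "s \<in> {0..1}" for s
    unfolding radial_mean_def
  proof (rule dominated_convergence(2))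
    show "(\<lambda>t. real N * t ^ (N - 1) * hn n (s * t)) integrable_on {0..1}" for n
      by (intro integrable_continuous_real continuous_on_radial_integrand hn s)
    show "(\<lambda>t::real. real N * B) integrable_on {0..1}"
      by (intro integrable_continuous_real continuous_intros)
    show "norm (real N * t ^ (N - 1) * hn n (s * t)) \<le> real N * B" if t: "t \<in> {0..1}" for n t
    proof -
      have "0 \<le> t ^ (N - 1)" "t ^ (N - 1) \<le> 1" using t by (auto intro: power_le_one)
      moreover note nn[OF mult_in_unit[OF s t], of n] B[OF mult_in_unit[OF s t], of n]
      ultimately have "t ^ (N - 1) * hn n (s * t) \<le> 1 * B" "0 \<le> t ^ (N - 1) * hn n (s * t)"
        using mult_mono[of "t ^ (N - 1)" 1 "hn n (s * t)" B] by auto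
      then show ?thesis by (simp add: abs_mult mult.assoc mult_left_mono)
    qed
    show "(\<lambda>n. real N * t ^ (N - 1) * hn n (s * t)) \<longlonglongrightarrow> real N * t ^ (N - 1) * h (s * t)"
      if t: "t \<in> {0..1}" for t
      by (intro tendsto_intros lim mult_in_unit s t)
  qed
  have "(\<lambda>n. integral {0..1} (\<lambda>t. r * flux N (hn n) (r * t)))
      \<longlonglongrightarrow> integral {0..1} (\<lambda>t. r * flux N h (r * t))"
  proof (rule dominated_convergence(2))
    show "(\<lambda>t. r * flux N (hn n) (r * t)) integrable_on {0..1}" for n
      using r by (intro integrable_continuous_real continuous_intros
          continuous_on_compose2[OF continuous_on_flux[OF hn]]) (auto simp: mult_le_one)
    show "(\<lambda>t::real. root N B) integrable_on {0..1}"
      by (intro integrable_continuous_real continuous_intros)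
    show "norm (r * flux N (hn n) (r * t)) \<le> root N B" if t: "t \<in> {0..1}" for n t
    proof -
      have "0 \<le> flux N (hn n) (r * t)" "flux N (hn n) (r * t) \<le> root N B"
        using flux_nonneg[OF N hn mult_in_unit[OF r t] nn] flux_le_root[OF N hn nn B mult_in_unit[OF r t]]
        by auto
      then show ?thesis
        using r mult_left_le_one_le[of "flux N (hn n) (r * t)" r] by (auto simp: abs_mult)
    qed
    show "(\<lambda>n. r * flux N (hn n) (r * t)) \<longlonglongrightarrow> r * flux N h (r * t)" if t: "t \<in> {0..1}" for t
      unfolding flux_def by (intro tendsto_intros m mult_in_unit r t)
  qed
  then show ?thesis by (simp add: descent_def)
qed

text \<open>The integral form of \<open>((- v')^N)' = N r^(N-1) G v\<close>, \<open>v 0 = d\<close>,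
  \<open>v' 0 = 0\<close> for nonnegative \<open>G\<close>. It mentions no derivative, so it
  survives uniform limits.\<close>

definition radial_ivp :: "nat \<Rightarrow> (real \<Rightarrow> real) \<Rightarrow> real \<Rightarrow> (real \<Rightarrow> real) \<Rightarrow> bool" where
  "radial_ivp N G d v \<longleftrightarrow> continuous_on {0..1} v \<and>
     (\<forall>r\<in>{0..1}. v r = d - descent N (\<lambda>t. G (v t)) r)"

text \<open>Picard iterates for the equation with delay \<open>e\<close>, started at the constant
  \<open>d p\<close>. The delayed time is clamped at 0, so on \<open>{0..e}\<close> the source only
  reads the initial value.\<close>

fun delayed_iterate ::
  "nat \<Rightarrow> real \<Rightarrow> (real \<Rightarrow> real \<Rightarrow> real) \<Rightarrow> (real \<Rightarrow> real) \<Rightarrow> nat \<Rightarrow> real \<Rightarrow> real \<Rightarrow> real" where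
  "delayed_iterate N e G d 0 p r = d p"
| "delayed_iterate N e G d (Suc k) p r =
     d p - descent N (\<lambda>t. G p (delayed_iterate N e G d k p (max 0 (t - e)))) r"

text \<open>Method of steps: by causality and the delay, agreement of two successive iterates up to
  \<open>k * e\<close> forces agreement of the next two up to \<open>(k + 1) * e\<close>. At radius
  0 all iterates equal \<open>d p\<close>.\<close>

lemma delayed_iterate_stable:
  assumes "e > 0" "r \<in> {0..1}" "r \<le> real k * e"
  shows "delayed_iterate N e G d (Suc k) p r = delayed_iterate N e G d k p r"
  using assms(2,3)
proof (induction k arbitrary: r)
  case (Suc k)
  have "descent N (\<lambda>t. G p (delayed_iterate N e G d (Suc k) p (max 0 (t - e)))) r
      = descent N (\<lambda>t. G p (delayed_iterate N e G d k p (max 0 (t - e)))) r"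
  proof (rule descent_cong[OF Suc.prems(1)])
    fix t assume "t \<in> {0..r}"
    then have "max 0 (t - e) \<in> {0..1}" "max 0 (t - e) \<le> real k * e"
      using Suc.prems assms(1) by (auto simp: algebra_simps)
    from Suc.IH[OF this]
    show "G p (delayed_iterate N e G d (Suc k) p (max 0 (t - e)))
        = G p (delayed_iterate N e G d k p (max 0 (t - e)))" by simp
  qed
  then show ?case by simp
qed simp

lemma continuous_on_delayed:
  fixes W G :: "real \<Rightarrow> real \<Rightarrow> real"
  assumes W: "continuous_on (A \<times> {0..1}) (\<lambda>(p, r). W p r)"
    and G: "continuous_on (A \<times> UNIV) (\<lambda>(p, s). G p s)" and e: "e \<ge> 0"
  shows "continuous_on (A \<times> {0..1}) (\<lambda>(p, t). G p (W p (max 0 (t - e))))"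
proof -
  have "continuous_on (A \<times> {0..1}) (\<lambda>x. (\<lambda>(p, r). W p r) (fst x, max 0 (snd x - e)))"
    using e by (intro continuous_on_compose2[OF W] continuous_intros) auto
  then have "continuous_on (A \<times> {0..1})
      (\<lambda>x. (\<lambda>(p, s). G p s) (fst x, W (fst x) (max 0 (snd x - e))))"
    by (intro continuous_on_compose2[OF G] continuous_intros) auto
  then show ?thesis by (simp add: case_prod_unfold)
qed

lemma continuous_on_delayed_iterate:
  fixes G :: "real \<Rightarrow> real \<Rightarrow> real"
  assumes G: "continuous_on (A \<times> UNIV) (\<lambda>(p, s). G p s)" and d: "continuous_on A d" and e: "e \<ge> 0"
  shows "continuous_on (A \<times> {0..1}) (\<lambda>(p, r). delayed_iterate N e G d k p r)"
proof -
  have d': "continuous_on (A \<times> {0..1::real}) (\<lambda>x. d (fst x))"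
    by (intro continuous_on_compose2[OF d] continuous_intros) auto
  show ?thesis
  proof (induction k)
    case 0
    then show ?case using d' by (simp add: case_prod_unfold)
  next
    case (Suc k)
    show ?case
      using continuous_on_diff[OF d' continuous_on_descent_param[OF continuous_on_delayed[OF Suc G e], of N]]
      by (simp add: case_prod_unfold)
  qed
qed

lemma delayed_solution_exists:
  fixes G :: "real \<Rightarrow> real \<Rightarrow> real"
  assumes G: "continuous_on (A \<times> UNIV) (\<lambda>(p, s). G p s)" and d: "continuous_on A d" and e: "e > 0"
  obtains W where "continuous_on (A \<times> {0..1}) (\<lambda>(p, r). W p r)"
    and "\<And>p r. r \<in> {0..1} \<Longrightarrow> W p r = d p - descent N (\<lambda>t. G p (W p (max 0 (t - e)))) r"
proof -
  \<comment> \<open>Once \<open>k * e\<close> exceeds 1, iterate \<open>k\<close> coincides with its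
    successor on the whole interval and is an exact solution. Being a finite iterate, it is
    continuous in the parameter without any uniqueness argument.\<close>
  obtain k :: nat where "1 / e < real k" using reals_Archimedean2 by blast
  then have k: "1 \<le> real k * e" using e by (simp add: field_simps)
  show ?thesis
  proof
    show "continuous_on (A \<times> {0..1}) (\<lambda>(p, r). delayed_iterate N e G d k p r)"
      using continuous_on_delayed_iterate[OF G d] e by simp
    show "delayed_iterate N e G d k p r
        = d p - descent N (\<lambda>t. G p (delayed_iterate N e G d k p (max 0 (t - e)))) r"
      if "r \<in> {0..1}" for p r
      using delayed_iterate_stable[OF e that, of k N G d p] k that by simp
  qed
qed

text \<open>Bounded sources give a common Lipschitz constant. A subsequence of the parameters
  converges by compactness and a further one of the solutions by Arzela-Ascoli; the same Lipschitz
  bound makes the delay disappear in the limit equation.\<close>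

lemma delayed_solutions_subconverge:
  fixes G :: "real \<Rightarrow> real \<Rightarrow> real"
  assumes N: "N \<ge> 1" and G: "continuous_on ({a..b} \<times> UNIV) (\<lambda>(p, s). G p s)"
    and G0: "\<And>p s. p \<in> {a..b} \<Longrightarrow> 0 \<le> G p s" and GB: "\<And>p s. p \<in> {a..b} \<Longrightarrow> G p s \<le> B"
    and d: "continuous_on {a..b} d"
    and p: "\<And>n. p n \<in> {a..b}" and e: "e \<longlonglongrightarrow> 0" "\<And>n. e n \<ge> 0"
    and V: "\<And>n. continuous_on {0..1} (V n)"
      "\<And>n r. r \<in> {0..1} \<Longrightarrow> V n r = d (p n) - descent N (\<lambda>t. G (p n) (V n (max 0 (t - e n)))) r"
  obtains k q v where "strict_mono (k :: nat \<Rightarrow> nat)" "q \<in> {a..b}" "radial_ivp N (G q) (d q) v"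
    "\<And>r. r \<in> {0..1} \<Longrightarrow> (\<lambda>n. V (k n) r) \<longlonglongrightarrow> v r"
proof -
  define H where "H n t = G (p n) (V n (max 0 (t - e n)))" for n t
  have Gc: "continuous_on {0..1} (\<lambda>t. G q (w t))" if "q \<in> {a..b}" "continuous_on {0..1} w" for q and w :: "real \<Rightarrow> real"
    by (rule continuous_on_compose2[OF continuous_on_slice[OF G that(1)] that(2)]) auto
  have shift: "max 0 (t - e n) \<in> {0..1}" if "t \<in> {0..1}" for t n
    using that e(2)[of n] by auto
  have Hc: "continuous_on {0..1} (H n)" for n
    unfolding H_def
    by (intro Gc p continuous_on_compose2[OF V(1)] continuous_intros) (use shift in auto)
  have H0: "0 \<le> H n t" and HB: "H n t \<le> B" for n t
    using G0[OF p] GB[OF p] by (auto simp: H_def)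
  have VH: "V n r = d (p n) - descent N (H n) r" if "r \<in> {0..1}" for n r
    using V(2)[OF that, of n] by (simp add: H_def[abs_def])
  have lip: "\<bar>V n r - V n s\<bar> \<le> root N B * \<bar>r - s\<bar>" if "r \<in> {0..1}" "s \<in> {0..1}" for n r s
    using descent_lipschitz[OF N Hc H0 HB that, of n] that by (simp add: VH)
  have "0 \<le> B" using H0 HB order_trans by blast
  then have L0: "0 \<le> root N B" using N by simp
  obtain q k1 where q: "q \<in> {a..b}" "strict_mono (k1 :: nat \<Rightarrow> nat)" "(p \<circ> k1) \<longlonglongrightarrow> q"
    using compact_Icc[of a b] p unfolding compact_def by metis
  obtain M where M: "\<And>x. x \<in> {a..b} \<Longrightarrow> norm (d x) \<le> M"
    using compact_imp_bounded[OF compact_continuous_image[OF d compact_Icc]]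
    unfolding bounded_iff by blast
  have bd: "norm (V (k1 n) r) \<le> M + root N B" if "r \<in> {0..1}" for n r
  proof -
    have "V (k1 n) 0 = d (p (k1 n))" by (simp add: VH)
    moreover have "\<bar>V (k1 n) r - V (k1 n) 0\<bar> \<le> root N B * 1"
      using lip[OF that, of 0 "k1 n"] that L0 mult_left_mono[of r 1 "root N B"] by auto
    ultimately show ?thesis using M[OF p, of "k1 n"] by auto
  qed
  \<comment> \<open>The summand 1 in the denominator covers the case of Lipschitz constant
    zero.\<close>
  have equi: "\<exists>\<delta>. 0 < \<delta> \<and> (\<forall>n y. y \<in> {0..1} \<and> norm (x - y) < \<delta>
      \<longrightarrow> norm (V (k1 n) x - V (k1 n) y) < \<epsilon>)" if "x \<in> {0..1}" "0 < \<epsilon>" for x \<epsilon> :: real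
  proof (intro exI conjI allI impI)
    show "0 < \<epsilon> / (root N B + 1)" using that L0 by simp
    fix n y assume y: "y \<in> {0..1} \<and> norm (x - y) < \<epsilon> / (root N B + 1)"
    have "\<bar>V (k1 n) x - V (k1 n) y\<bar> \<le> root N B * \<bar>x - y\<bar>" using lip that y by blast
    also have "\<dots> \<le> (root N B + 1) * \<bar>x - y\<bar>" by (intro mult_right_mono) auto
    also have "\<dots> < \<epsilon>" using y L0 by (simp add: field_simps)
    finally show "norm (V (k1 n) x - V (k1 n) y) < \<epsilon>" by simp
  qed
  obtain v k2 where v: "continuous_on {0..1} v" and k2: "strict_mono (k2 :: nat \<Rightarrow> nat)"
    and unif: "\<And>\<epsilon>. 0 < \<epsilon> \<Longrightarrow>
      \<exists>n0. \<forall>n x. n \<ge> n0 \<and> x \<in> {0..1} \<longrightarrow> norm (V (k1 (k2 n)) x - v x) < \<epsilon>"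
    using Arzela_Ascoli[of "{0..1::real}" "\<lambda>n. V (k1 n)" "M + root N B", OF _ bd equi] by auto
  define k where "k = k1 \<circ> k2"
  have k: "strict_mono k" unfolding k_def using q(2) k2 by (rule strict_mono_o)
  have Vk: "(\<lambda>n. V (k n) r) \<longlonglongrightarrow> v r" if "r \<in> {0..1}" for r
    using unif that unfolding LIMSEQ_def k_def dist_norm by (metis comp_apply)
  have pk: "(\<lambda>n. p (k n)) \<longlonglongrightarrow> q"
    using LIMSEQ_subseq_LIMSEQ[OF q(3) k2] by (simp add: k_def comp_def)
  have ek: "(\<lambda>n. e (k n)) \<longlonglongrightarrow> 0"
    using LIMSEQ_subseq_LIMSEQ[OF e(1) k] by (simp add: comp_def)
  have Hk: "(\<lambda>n. H (k n) t) \<longlonglongrightarrow> G q (v t)" if t: "t \<in> {0..1}" for t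
  proof -
    have "\<bar>V (k n) (max 0 (t - e (k n))) - V (k n) t\<bar> \<le> root N B * e (k n)" for n
    proof -
      have "\<bar>max 0 (t - e (k n)) - t\<bar> \<le> e (k n)" using e(2)[of "k n"] t by auto
      from order_trans[OF lip[OF shift[OF t] t] mult_left_mono[OF this L0]] show ?thesis .
    qed
    moreover have "(\<lambda>n. root N B * e (k n)) \<longlonglongrightarrow> 0"
      using tendsto_mult_right_zero[OF ek] by simp
    ultimately have "(\<lambda>n. V (k n) (max 0 (t - e (k n))) - V (k n) t) \<longlonglongrightarrow> 0"
      by (auto intro: Lim_null_comparison[rotated])
    from tendsto_add[OF this Vk[OF t]]
    have *: "(\<lambda>n. V (k n) (max 0 (t - e (k n)))) \<longlonglongrightarrow> v t" by simp
    have "(\<lambda>n. (\<lambda>(p, s). G p s) (p (k n), V (k n) (max 0 (t - e (k n)))))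
        \<longlonglongrightarrow> (\<lambda>(p, s). G p s) (q, v t)"
      by (rule continuous_on_tendsto_compose[OF G tendsto_Pair[OF pk *]]) (use q p in auto)
    then show ?thesis by (simp add: H_def)
  qed
  have "v r = d q - descent N (\<lambda>t. G q (v t)) r" if r: "r \<in> {0..1}" for r
  proof (rule LIMSEQ_unique[OF Vk[OF r]])
    have "(\<lambda>n. d (p (k n)) - descent N (H (k n)) r) \<longlonglongrightarrow> d q - descent N (\<lambda>t. G q (v t)) r"
      by (intro tendsto_diff continuous_on_tendsto_compose[OF d pk]
          tendsto_descent[OF N Hc Gc[OF q(1) v] H0 HB Hk r]) (use q p in auto)
    then show "(\<lambda>n. V (k n) r) \<longlonglongrightarrow> d q - descent N (\<lambda>t. G q (v t)) r"
      using r by (simp add: VH)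
  qed
  then have "radial_ivp N (G q) (d q) v" using v by (simp add: radial_ivp_def)
  with k q(1) show ?thesis using Vk that by blast
qed

text \<open>The sign conditions are imposed on every solution at the end parameters, since there may
  be several. They pass to the delayed solutions for small delay, where the end value is a
  continuous function of the parameter; its zeros then subconverge.\<close>

lemma radial_shooting:
  fixes G :: "real \<Rightarrow> real \<Rightarrow> real"
  assumes N: "N \<ge> 1" and ab: "a \<le> b" and G: "continuous_on ({a..b} \<times> UNIV) (\<lambda>(p, s). G p s)"
    and G0: "\<And>p s. p \<in> {a..b} \<Longrightarrow> 0 \<le> G p s" and GB: "\<And>p s. p \<in> {a..b} \<Longrightarrow> G p s \<le> B"
    and d: "continuous_on {a..b} d"
    and lo: "\<And>v. radial_ivp N (G a) (d a) v \<Longrightarrow> v 1 > 0"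
    and hi: "\<And>v. radial_ivp N (G b) (d b) v \<Longrightarrow> v 1 < 0"
  obtains p v where "p \<in> {a..b}" "radial_ivp N (G p) (d p) v" "v 1 = 0"
proof -
  define e where "e n = 1 / real (Suc n)" for n
  have e: "e n > 0" for n by (simp add: e_def)
  have e0: "e \<longlonglongrightarrow> 0" unfolding e_def[abs_def] by (rule LIMSEQ_Suc[OF lim_1_over_n])
  have "\<forall>n. \<exists>W. continuous_on ({a..b} \<times> {0..1}) (\<lambda>(p, r). W p r) \<and>
      (\<forall>p. \<forall>r\<in>{0..1}. W p r = d p - descent N (\<lambda>t. G p (W p (max 0 (t - e n)))) r)"
    using delayed_solution_exists[OF G d e] by metis
  then obtain W where Wc: "\<And>n. continuous_on ({a..b} \<times> {0..1}) (\<lambda>(p, r). W n p r)"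
    and W: "\<And>n p r. r \<in> {0..1} \<Longrightarrow> W n p r = d p - descent N (\<lambda>t. G p (W n p (max 0 (t - e n)))) r"
    by metis
  \<comment> \<open>Stated for a subinterval so as to serve three times: on the degenerate intervals
    at \<open>a\<close> and at \<open>b\<close>, and on all of \<open>{a..b}\<close>.\<close>
  have conv: "\<exists>k q v. strict_mono (k :: nat \<Rightarrow> nat) \<and> q \<in> {l..u} \<and> radial_ivp N (G q) (d q) v \<and>
      (\<lambda>n. W (j (k n)) (p (k n)) 1) \<longlonglongrightarrow> v 1"
    if lu: "{l..u} \<subseteq> {a..b}" and j: "strict_mono (j :: nat \<Rightarrow> nat)" and p: "\<And>n. p n \<in> {l..u}" for l u j p
  proof -
    have G': "continuous_on ({l..u} \<times> UNIV) (\<lambda>(p, s). G p s)"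
      by (rule continuous_on_subset[OF G]) (use lu in auto)
    have ej: "(\<lambda>n. e (j n)) \<longlonglongrightarrow> 0"
      using LIMSEQ_subseq_LIMSEQ[OF e0 j] by (simp add: comp_def)
    have Wj: "continuous_on {0..1} (W (j n) (p n))" for n
      by (rule continuous_on_slice[OF Wc]) (use p lu in blast)
    obtain k q v where "strict_mono (k :: nat \<Rightarrow> nat)" "q \<in> {l..u}" "radial_ivp N (G q) (d q) v"
      and v: "\<And>r. r \<in> {0..1} \<Longrightarrow> (\<lambda>n. W (j (k n)) (p (k n)) r) \<longlonglongrightarrow> v r"
    proof (rule delayed_solutions_subconverge[OF N G' _ _ continuous_on_subset[OF d lu] p ej _ Wj])
      show "0 \<le> G q s" "G q s \<le> B" if "q \<in> {l..u}" for q s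
        using G0[of q s] GB[of q s] lu that by auto
      show "0 \<le> e (j n)" for n using e less_imp_le by blast
    qed (rule W, assumption, rule that)
    moreover have "(\<lambda>n. W (j (k n)) (p (k n)) 1) \<longlonglongrightarrow> v 1" by (rule v) simp
    ultimately show ?thesis by blast
  qed
  \<comment> \<open>Otherwise a subsequence of nonpositive end values would converge to that of an
    undelayed solution at \<open>a\<close>, against \<open>lo\<close>.\<close>
  have "\<forall>\<^sub>F n in sequentially. W n a 1 > 0"
  proof (rule ccontr)
    assume "\<not> ?thesis"
    then obtain j where j: "strict_mono (j :: nat \<Rightarrow> nat)" "\<And>n. W (j n) a 1 \<le> 0"
      using not_eventually_sequentiallyD by (metis not_less)
    from conv[of a a j "\<lambda>_. a"] j(1) ab obtain k v where
      "radial_ivp N (G a) (d a) v" "(\<lambda>n. W (j (k n)) a 1) \<longlonglongrightarrow> v 1" by auto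
    then have "v 1 > 0" "v 1 \<le> 0"
      using lo j(2) by (auto intro: LIMSEQ_le_const2)
    then show False by simp
  qed
  moreover have "\<forall>\<^sub>F n in sequentially. W n b 1 < 0"
  proof (rule ccontr)
    assume "\<not> ?thesis"
    then obtain j where j: "strict_mono (j :: nat \<Rightarrow> nat)" "\<And>n. W (j n) b 1 \<ge> 0"
      using not_eventually_sequentiallyD by (metis not_less)
    from conv[of b b j "\<lambda>_. b"] j(1) ab obtain k v where
      "radial_ivp N (G b) (d b) v" "(\<lambda>n. W (j (k n)) b 1) \<longlonglongrightarrow> v 1" by auto
    then have "v 1 < 0" "v 1 \<ge> 0"
      using hi j(2) by (auto intro: LIMSEQ_le_const)
    then show False by simp
  qed
  ultimately have "\<forall>\<^sub>F n in sequentially. \<exists>p\<in>{a..b}. W n p 1 = 0"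
  proof eventually_elim
    case (elim n)
    have "continuous_on {a..b} (\<lambda>p. (\<lambda>(p, r). W n p r) (p, 1))"
      by (intro continuous_on_compose2[OF Wc] continuous_intros) auto
    then show ?case
      using IVT2'[of "\<lambda>p. W n p 1" b 0 a] elim ab by auto
  qed
  then obtain n0 where "\<forall>n\<ge>n0. \<exists>p\<in>{a..b}. W n p 1 = 0"
    by (auto simp: eventually_sequentially)
  then have "\<forall>n. \<exists>p\<in>{a..b}. W (n0 + n) p 1 = 0" by simp
  then obtain p where p: "\<And>n. p n \<in> {a..b}" "\<And>n. W (n0 + n) (p n) 1 = 0" by metis
  from conv[of a b "\<lambda>n. n0 + n" p] p(1) obtain k q v where
    "q \<in> {a..b}" "radial_ivp N (G q) (d q) v" "(\<lambda>n. W (n0 + k n) (p (k n)) 1) \<longlonglongrightarrow> v 1"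
    by (auto simp: strict_mono_def)
  moreover from this(3) have "v 1 = 0"
    by (simp add: p(2) LIMSEQ_const_iff)
  ultimately show ?thesis using that by blast
qed

section \<open>Concave profiles and comparison\<close>

locale radial_solution =
  fixes N :: nat and G v :: "real \<Rightarrow> real" and d :: real
  assumes N: "N \<ge> 1" and G: "continuous_on UNIV G" and G_nonneg: "\<And>s. 0 \<le> G s"
    and ivp: "radial_ivp N G d v"
begin

abbreviation src :: "real \<Rightarrow> real" where "src t \<equiv> G (v t)"

lemma v_continuous: "continuous_on {0..1} v"
  using ivp by (simp add: radial_ivp_def)

lemma v_eq: "r \<in> {0..1} \<Longrightarrow> v r = d - descent N src r"
  using ivp by (simp add: radial_ivp_def)

lemma src_continuous: "continuous_on {0..1} src"
  by (rule continuous_on_compose2[OF G v_continuous]) simp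

lemma v_0 [simp]: "v 0 = d"
  using v_eq[of 0] by simp

lemma v_derivative: "r \<in> {0..1} \<Longrightarrow> (v has_real_derivative - flux N src r) (at r within {0..1})"
  by (rule has_field_derivative_transform_within[of "\<lambda>r. d - descent N src r" _ _ _ 1])
    (auto intro!: derivative_eq_intros has_real_derivative_descent src_continuous simp: v_eq)

lemma v_le: "r \<in> {0..1} \<Longrightarrow> v r \<le> d"
proof -
  assume r: "r \<in> {0..1}"
  have "0 \<le> descent N src r"
    by (rule descent_nonneg[OF N src_continuous G_nonneg r])
  then show ?thesis using v_eq[OF r] by simp
qed

text \<open>By concavity \<open>v\<close> lies above the chord from height \<open>d\<close> to
  height \<open>v 1\<close>, and the contribution \<open>r * v 1\<close> is nonnegative.\<close>

lemma v_ge_linear: "0 \<le> v 1 \<Longrightarrow> r \<in> {0..1} \<Longrightarrow> d * (1 - r) \<le> v r"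
proof -
  assume v1: "0 \<le> v 1" and r: "r \<in> {0..1}"
  have "descent N src r \<le> r * descent N src 1"
    using descent_le_linear[OF N src_continuous G_nonneg r] .
  moreover have "r * (d - descent N src 1) \<ge> 0"
    using v1 v_eq[of 1] r by simp
  ultimately show ?thesis using v_eq[OF r] by (simp add: algebra_simps)
qed

text \<open>If \<open>v 1\<close> were nonnegative, \<open>v\<close> would stay in
  \<open>{d / 2..d}\<close> on the first half of the interval. The flux there is at least
  \<open>m * d / 2 * s\<close>, so the drop up to \<open>1/2\<close> is at least
  \<open>(m * d / 2) * (1/8) = m * d / 16\<close>, more than the initial height. This is the origin
  of the constant 16.\<close>

lemma steep_crosses_zero:
  assumes "0 < d" "16 < m" "\<And>s. s \<in> {d / 2..d} \<Longrightarrow> (m * s) ^ N \<le> G s"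
  shows "v 1 < 0"
proof (rule ccontr)
  assume "\<not> v 1 < 0"
  then have v1: "0 \<le> v 1" by simp
  have fl: "m * d / 2 * s \<le> flux N src s" if s: "s \<in> {0..1/2}" for s
  proof -
    have "(m * d / 2) ^ N \<le> src t" if t: "t \<in> {0..s}" for t
    proof -
      have "d * (1 / 2) \<le> d * (1 - t)" using s t assms(1) by (intro mult_left_mono) auto
      also have "\<dots> \<le> v t" using v_ge_linear[OF v1, of t] s t by auto
      finally have "v t \<in> {d / 2..d}" using v_le[of t] s t by auto
      moreover from this have "(m * d / 2) ^ N \<le> (m * v t) ^ N"
        using assms(1,2) by (intro power_mono) auto
      ultimately show ?thesis using assms(3)[of "v t"] by simp
    qed
    then have "flux N (\<lambda>_. (m * d / 2) ^ N) s \<le> flux N src s"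
      using s by (intro flux_mono_fun N src_continuous continuous_intros) auto
    then show ?thesis using flux_const_power[OF N, of "m * d / 2" s] assms(1,2) by simp
  qed
  have "integral {0..1/2} (\<lambda>s. m * d / 2 * s) \<le> integral {0..1/2} (flux N src)"
    by (intro integral_le fl integrable_continuous_real continuous_intros
        continuous_on_subset[OF continuous_on_flux[OF src_continuous]]) auto
  moreover have "integral {0..1/2} (\<lambda>s. m * d / 2 * s) = m * d / 16"
    using integral_unique[OF ident_has_integral[of 0 "1/2::real"]] by (simp add: power2_eq_square)
  ultimately have "m * d / 16 \<le> descent N src (1/2)"
    by (simp add: descent_eq_integral power2_eq_square)
  moreover have "0 \<le> v (1/2)" using v_ge_linear[OF v1, of "1/2"] assms(1) by simp
  moreover have "16 * d < m * d" using assms by simp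
  ultimately show False using v_eq[of "1/2"] by simp
qed

end

text \<open>Let \<open>T u r\<close> denote the descent from \<open>r\<close> to 1 with source
  \<open>u ^ N\<close>. The iteration of \<open>w \<le> mu T w\<close> against
  \<open>phi = lam T phi\<close> needs an initial bound \<open>w \<le> C phi\<close>, although
  \<open>phi\<close> vanishes at 1. It exists because \<open>w\<close> is at most, and
  \<open>phi\<close> at least, a multiple of \<open>1 - r\<close>.\<close>

lemma eigenfunction_comparison:
  assumes N: "N \<ge> 1" and mu: "0 \<le> mu" "mu < lam"
    and phi: "continuous_on {0..1} phi" "\<And>r. r \<in> {0..1} \<Longrightarrow> 0 \<le> phi r" "0 < phi 0"
      "\<And>r. r \<in> {0..1} \<Longrightarrow>
        phi r = lam * (descent N (\<lambda>t. phi t ^ N) 1 - descent N (\<lambda>t. phi t ^ N) r)"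
    and w: "continuous_on {0..1} w" "\<And>r. r \<in> {0..1} \<Longrightarrow> 0 \<le> w r"
      "\<And>r. r \<in> {0..1} \<Longrightarrow>
        w r \<le> mu * (descent N (\<lambda>t. w t ^ N) 1 - descent N (\<lambda>t. w t ^ N) r)"
    and r: "r \<in> {0..1}"
  shows "w r \<le> 0"
proof -
  have cphi: "continuous_on {0..1} (\<lambda>t. phi t ^ N)" and cw: "continuous_on {0..1} (\<lambda>t. w t ^ N)"
    by (intro continuous_intros phi w)+
  have fphi: "flux N (\<lambda>t. phi t ^ N) integrable_on {r..1}"
    and fw: "flux N (\<lambda>t. w t ^ N) integrable_on {r..1}" if "r \<in> {0..1}" for r
    using that by (auto intro!: integrable_continuous_real
        continuous_on_subset[OF continuous_on_flux[OF cphi]] continuous_on_subset[OF continuous_on_flux[OF cw]])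
  have lam: "0 < lam" using mu by simp
  have "\<exists>B. \<forall>t\<in>{0..1}. norm (w t) \<le> B"
    using compact_imp_bounded[OF compact_continuous_image[OF w(1) compact_Icc]]
    unfolding bounded_iff by blast
  then obtain B where B: "\<And>t. t \<in> {0..1} \<Longrightarrow> w t \<le> B" by (metis abs_le_D1 real_norm_def)
  have B0: "0 \<le> B" using B[of 0] w(2)[of 0] by simp
  have phi_lin: "phi 0 * (1 - r) \<le> phi r" if "r \<in> {0..1}" for r
  proof -
    have "descent N (\<lambda>t. phi t ^ N) r \<le> r * descent N (\<lambda>t. phi t ^ N) 1"
      using phi(2) by (intro descent_le_linear N cphi that) auto
    then have "lam * descent N (\<lambda>t. phi t ^ N) r \<le> lam * (r * descent N (\<lambda>t. phi t ^ N) 1)"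
      using lam by simp
    then show ?thesis using phi(4)[OF that] phi(4)[of 0] by (simp add: algebra_simps)
  qed
  have w_lin: "w r \<le> mu * B * (1 - r)" if r: "r \<in> {0..1}" for r
  proof -
    have "flux N (\<lambda>t. w t ^ N) s \<le> B" if "s \<in> {r..1}" for s
      using flux_le_root[OF N cw, of "B ^ N" s] w(2) B that r N B0
      by (auto simp: real_root_power_cancel intro!: power_mono)
    then have "integral {r..1} (flux N (\<lambda>t. w t ^ N)) \<le> integral {r..1} (\<lambda>_. B)"
      using r by (intro integral_le fw) auto
    then have "mu * integral {r..1} (flux N (\<lambda>t. w t ^ N)) \<le> mu * (B * (1 - r))"
      using r mu by (intro mult_left_mono) (auto simp: mult.commute)
    then show ?thesis using w(3)[OF r] descent_diff[OF cw r] by simp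
  qed
  define C where "C = mu * B / phi 0"
  have C0: "0 \<le> C" using mu B0 phi(3) by (simp add: C_def)
  \<comment> \<open>Each application of the monotone, homogeneous operator gains a factor
    \<open>mu / lam < 1\<close>.\<close>
  have iter: "\<forall>r\<in>{0..1}. w r \<le> (mu / lam) ^ n * C * phi r" for n
  proof (induction n)
    case 0
    have "w r \<le> C * phi r" if "r \<in> {0..1}" for r
    proof -
      have "w r \<le> C * (phi 0 * (1 - r))" using w_lin[OF that] phi(3) by (simp add: C_def)
      also have "\<dots> \<le> C * phi r" using phi_lin[OF that] C0 by (rule mult_left_mono)
      finally show ?thesis .
    qed
    then show ?case by simp
  next
    case (Suc n)
    define c where "c = (mu / lam) ^ n * C"
    have c0: "0 \<le> c" using mu C0 by (simp add: c_def)
    show ?case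
    proof
      fix r :: real assume r: "r \<in> {0..1}"
      have "flux N (\<lambda>t. w t ^ N) s \<le> c * flux N (\<lambda>t. phi t ^ N) s" if s: "s \<in> {r..1}" for s
      proof -
        have "w t ^ N \<le> c ^ N * phi t ^ N" if t: "t \<in> {0..s}" for t
        proof -
          have "t \<in> {0..1}" using s t r by auto
          then have "w t ^ N \<le> (c * phi t) ^ N"
            using Suc w(2)[of t] by (intro power_mono) (auto simp: c_def)
          then show ?thesis by (simp add: power_mult_distrib)
        qed
        then have "flux N (\<lambda>t. w t ^ N) s \<le> flux N (\<lambda>t. c ^ N * phi t ^ N) s"
          using r s by (intro flux_mono_fun N cw continuous_intros phi(1)) auto
        then show ?thesis by (simp add: flux_cmult_power[OF N c0])
      qed
      then have "integral {r..1} (flux N (\<lambda>t. w t ^ N))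
          \<le> integral {r..1} (\<lambda>s. c * flux N (\<lambda>t. phi t ^ N) s)"
        using r by (intro integral_le fw integrable_on_mult_right fphi) auto
      then have "mu * integral {r..1} (flux N (\<lambda>t. w t ^ N))
          \<le> mu * (c * integral {r..1} (flux N (\<lambda>t. phi t ^ N)))"
        using mu by (intro mult_left_mono) auto
      also have "\<dots> = mu / lam * c * phi r"
        using phi(4)[OF r] descent_diff[OF cphi r, of N] lam by simp
      finally show "w r \<le> (mu / lam) ^ Suc n * C * phi r"
        using w(3)[OF r] descent_diff[OF cw r, of N] by (simp add: c_def mult_ac)
    qed
  qed
  have "(\<lambda>n. (mu / lam) ^ n * C * phi r) \<longlonglongrightarrow> 0 * C * phi r"
    using mu by (intro tendsto_intros LIMSEQ_power_zero) auto
  then show ?thesis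
    using iter r by (auto intro!: LIMSEQ_le_const[of _ 0 "w r"])
qed

text \<open>The mean value theorem on both sides of the intermediate point \<open>z\<close> yields
  slopes \<open>u' p > u' q\<close>. The concavity defect is their difference times
  \<open>t * (1 - t) * (y - x)\<close>.\<close>

lemma strictly_concave_onI_deriv:
  fixes u u' :: "real \<Rightarrow> real"
  assumes d: "\<And>x. x \<in> {a<..<b} \<Longrightarrow> (u has_real_derivative u' x) (at x)"
    and dec: "\<And>x y. a < x \<Longrightarrow> x < y \<Longrightarrow> y < b \<Longrightarrow> u' y < u' x"
  shows "strictly_concave_on {a<..<b} u"
proof -
  have main: "u ((1 - t) * x + t * y) > (1 - t) * u x + t * u y"
    if xy: "x \<in> {a<..<b}" "y \<in> {a<..<b}" "x < y" "0 < t" "t < 1" for x y t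
  proof -
    define z where "z = (1 - t) * x + t * y"
    have z: "z - x = t * (y - x)" "y - z = (1 - t) * (y - x)" by (auto simp: z_def algebra_simps)
    have "0 < t * (y - x)" "0 < (1 - t) * (y - x)" using that by simp_all
    then have xz: "x < z" "z < y" unfolding z[symmetric] by simp_all
    obtain p where p: "x < p" "p < z" "u z - u x = (z - x) * u' p"
      using MVT2[OF xz(1), of u u'] d xy xz by auto
    obtain q where q: "z < q" "q < y" "u y - u z = (y - z) * u' q"
      using MVT2[OF xz(2), of u u'] d xy xz by auto
    have "u' q < u' p" using dec[of p q] p q that by auto
    then have "0 < t * (1 - t) * (y - x) * (u' p - u' q)" using that by simp
    also have "\<dots> = (1 - t) * (u z - u x) - t * (u y - u z)"
      by (simp add: p(3) q(3) z algebra_simps)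
    finally show ?thesis unfolding z_def[symmetric] by (simp add: algebra_simps)
  qed
  show ?thesis
    unfolding strictly_concave_on_def
  proof (intro ballI allI impI)
    fix x y t assume A: "x \<in> {a<..<b}" "y \<in> {a<..<b}" "x \<noteq> y \<and> 0 < t \<and> t < (1::real)"
    show "(1 - t) * u x + t * u y < u ((1 - t) * x + t * y)"
    proof (cases "x < y")
      case True then show ?thesis using main A by blast
    next
      case False
      then show ?thesis using main[of y x "1 - t"] A by (simp add: algebra_simps)
    qed
  qed
qed

text \<open>Writing the equation for \<open>- v'\<close> keeps the base of the power nonnegative
  along the decreasing profiles constructed here. One notion then serves the eigenvalue problem and
  both signs of solution, depending on the choice of \<open>G\<close>.\<close>

definition radial_profile :: "nat \<Rightarrow> (real \<Rightarrow> real) \<Rightarrow> (real \<Rightarrow> real) \<Rightarrow> (real \<Rightarrow> real) \<Rightarrow> (real \<Rightarrow> real) \<Rightarrow> bool" where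
  "radial_profile N G v v' v'' \<longleftrightarrow> C2_01 v v' v'' \<and>
     (\<forall>r\<in>{0<..<1}. ((\<lambda>s. (- v' s) ^ N) has_real_derivative real N * r ^ (N - 1) * G (v r)) (at r)) \<and>
     v' 0 = 0 \<and> v 1 = 0 \<and> (\<forall>r\<in>{0<..<1}. 0 < v r) \<and> strictly_concave_on {0<..<1} v"

lemma at_within_unit: "r \<in> {0<..<1::real} \<Longrightarrow> at r within {0..1} = at r"
  by (rule at_within_interior) (simp add: interior_atLeastAtMost_real)

section \<open>Regularity and concavity of solutions that vanish at 1\<close>

context radial_solution
begin

lemma radial_profile_exists:
  assumes d: "0 < d" and v1: "v 1 = 0" and G_pos: "\<And>s. s \<in> {0<..d} \<Longrightarrow> 0 < G s"
  obtains v' v'' where "radial_profile N G v v' v''"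
proof -
  have v_pos: "0 < v r" if "r \<in> {0..<1}" for r
    using v_ge_linear[of r] v1 d that by (auto intro: less_le_trans[rotated])
  have src_pos: "0 < src r" if "r \<in> {0..<1}" for r
    using G_pos[of "v r"] v_pos[OF that] v_le[of r] that by auto
  \<comment> \<open>The source may vanish at 1, but its mean there does not. The denominator of
    \<open>v''\<close> therefore stays positive on the closed interval, which gives the C2
    regularity up to both endpoints.\<close>
  have mean_pos: "0 < radial_mean N src s" if "s \<in> {0..1}" for s
    using that by (intro radial_mean_pos N src_continuous G_nonneg src_pos) auto
  define v'' where "v'' r = - (src r / root N (radial_mean N src r) ^ (N - 1))" for r
  have d1: "((\<lambda>r. - flux N src r) has_real_derivative v'' r) (at r within {0..1})" if "r \<in> {0..1}" for r
    unfolding v''_def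
    by (intro DERIV_minus has_real_derivative_flux N src_continuous G_nonneg mean_pos that)
  have c2: "continuous_on {0..1} v''"
    unfolding v''_def
    using mean_pos N
    by (intro continuous_intros src_continuous continuous_on_radial_mean)
      (metis less_irrefl real_root_gt_zero less_eq_Suc_le One_nat_def power_not_zero)
  have v''_neg: "v'' r < 0" if "r \<in> {0<..<1}" for r
    using src_pos[of r] mean_pos[of r] that N by (simp add: v''_def)
  have "radial_profile N G v (\<lambda>r. - flux N src r) v''"
    unfolding radial_profile_def C2_01_def
  proof (intro conjI ballI)
    fix r :: real assume r: "r \<in> {0<..<1}"
    then have "((\<lambda>s. flux N src s ^ N) has_real_derivative real N * r ^ (N - 1) * src r) (at r within {0..1})"
      by (intro has_real_derivative_flux_power N src_continuous G_nonneg) auto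
    then show "((\<lambda>s. (- (- flux N src s)) ^ N) has_real_derivative real N * r ^ (N - 1) * src r) (at r)"
      using at_within_unit[OF r] by simp
    show "0 < v r" using r by (intro v_pos) auto
  next
    show "strictly_concave_on {0<..<1} v"
    proof (rule strictly_concave_onI_deriv)
      show "(v has_real_derivative - flux N src x) (at x)" if "x \<in> {0<..<1}" for x
        using v_derivative[of x] at_within_unit[OF that] that by auto
      show "- flux N src y < - flux N src x" if "0 < x" "x < y" "y < 1" for x y
      proof (rule DERIV_neg_imp_decreasing[OF that(2)])
        fix z assume "x \<le> z" "z \<le> y"
        then have z: "z \<in> {0<..<1}" using that by auto
        then show "\<exists>c. ((\<lambda>r. - flux N src r) has_real_derivative c) (at z) \<and> c < 0"
          using d1[of z] v''_neg[OF z] at_within_unit[OF z] by auto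
      qed
    qed
  qed (use v_derivative d1 c2 v1 in \<open>auto simp: flux_def\<close>)
  then show ?thesis using that by blast
qed

end

section \<open>The first eigenvalue and the superlinear problem\<close>

text \<open>Integrating the equation determines only \<open>(- v')^N\<close>, which for even
  \<open>N\<close> leaves the sign of \<open>v'\<close> open. The sign follows because
  \<open>v'\<close> has no zero inside and \<open>v\<close> must fall from positive values to
  0.\<close>

lemma positive_eigenfunction_integral_form:
  assumes N: "N \<ge> 1" and lam: "0 < lam" and ev: "has_positive_eigenfunction N lam"
  obtains phi where "continuous_on {0..1} phi" "\<And>r. r \<in> {0..1} \<Longrightarrow> 0 \<le> phi r" "0 < phi 0"
    "\<And>r. r \<in> {0..1} \<Longrightarrow>
      phi r = lam * (descent N (\<lambda>t. phi t ^ N) 1 - descent N (\<lambda>t. phi t ^ N) r)"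
proof -
  from ev obtain v v' v'' where C2: "C2_01 v v' v''"
    and ode: "\<And>r. r \<in> {0<..<1} \<Longrightarrow> ((\<lambda>s. (- v' s) ^ N) has_real_derivative
      lam ^ N * real N * r ^ (N - 1) * (v r) ^ N) (at r)"
    and bc: "v' 0 = 0" "v 1 = 0" and pos: "\<And>r. r \<in> {0<..<1} \<Longrightarrow> 0 < v r"
    unfolding has_positive_eigenfunction_def by blast
  have dv: "(v has_real_derivative v' r) (at r)" if "r \<in> {0<..<1}" for r
  proof -
    have "(v has_real_derivative v' r) (at r within {0..1})"
      using C2 that by (simp add: C2_01_def)
    then show ?thesis by (simp add: at_within_unit[OF that])
  qed
  have vc: "continuous_on {0..1} v" and v'c: "continuous_on {0..1} v'"
    using C2 unfolding C2_01_def continuous_on_eq_continuous_within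
    by (blast intro: DERIV_continuous)+
  have nn: "0 \<le> v r" if "r \<in> {0..1}" for r
    using continuous_ge_on_closure[of "{0<..<1}" v r 0] vc pos that by (auto intro: less_imp_le)
  define h where "h t = v t ^ N" for t
  have hc: "continuous_on {0..1} h" unfolding h_def by (intro continuous_intros vc)
  have h0: "0 \<le> h t" if "t \<in> {0..1}" for t using nn[OF that] by (simp add: h_def)
  have fc: "continuous_on {0..1} (flux N h)" by (rule continuous_on_flux[OF hc])
  have flux_pos: "0 < flux N h s" if "s \<in> {0<..<1}" for s
    using radial_mean_pos[OF N hc _ h0, of s] pos[of "s / 2"] that N by (auto simp: flux_def h_def[abs_def])
  \<comment> \<open>Both sides have the same derivative inside and vanish at 0.\<close>
  have pow: "(- v' s) ^ N = (lam * flux N h s) ^ N" if "s \<in> {0..1}" for s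
  proof -
    have "(- v' s) ^ N - lam ^ N * flux N h s ^ N = (- v' 0) ^ N - lam ^ N * flux N h 0 ^ N"
    proof (rule DERIV_isconst2[of 0 1])
      show "continuous_on {0..1} (\<lambda>s. (- v' s) ^ N - lam ^ N * flux N h s ^ N)"
        by (intro continuous_intros v'c fc)
      fix x :: real assume "0 < x" "x < 1"
      then have x: "x \<in> {0<..<1}" by simp
      have "((\<lambda>s. flux N h s ^ N) has_real_derivative real N * x ^ (N - 1) * h x) (at x)"
        using has_real_derivative_flux_power[OF N hc h0, of x] x at_within_unit[OF x] by auto
      from DERIV_diff[OF ode[OF x] DERIV_cmult[OF this, of "lam ^ N"]]
      show "((\<lambda>s. (- v' s) ^ N - lam ^ N * flux N h s ^ N) has_real_derivative 0) (at x)"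
        by (simp add: h_def mult_ac)
    qed (use that in auto)
    moreover have "(0::real) ^ N = 0" using N by (simp add: zero_power)
    ultimately show ?thesis using bc(1) by (simp add: flux_def power_mult_distrib)
  qed
  have v'_nz: "v' s \<noteq> 0" if "s \<in> {0<..<1}" for s
    using pow[of s] flux_pos[OF that] that lam N by (auto simp: zero_power)
  \<comment> \<open>If \<open>v' s\<close> were positive, the mean value theorem between
    \<open>s\<close> and 1 would give a later point with negative derivative, and the intermediate
    value theorem a zero of \<open>v'\<close> in between.\<close>
  have v'_neg: "v' s < 0" if s: "s \<in> {0<..<1}" for s
  proof (rule ccontr)
    assume "\<not> v' s < 0"
    then have ps: "0 < v' s" using v'_nz[OF s] by simp
    have "\<exists>z>s. z < 1 \<and> v 1 - v s = (1 - s) * v' z"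
    proof -
      have "continuous_on {s..1} v" using s by (intro continuous_on_subset[OF vc]) auto
      moreover have "v differentiable (at x)" if "s < x" "x < 1" for x
        using dv[of x] s that real_differentiable_def by auto
      ultimately obtain l z where "s < z" "z < 1" "(v has_real_derivative l) (at z)" "v 1 - v s = (1 - s) * l"
        using MVT[of s 1 v] s by auto
      then show ?thesis using DERIV_unique[OF _ dv[of z]] s by auto
    qed
    then obtain z where z: "s < z" "z < 1" "v 1 - v s = (1 - s) * v' z" by blast
    have "(1 - s) * v' z < 0" using z(3) bc(2) pos[OF s] by linarith
    then have "v' z < 0" using s by (simp add: mult_less_0_iff)
    moreover have "continuous_on {s..z} v'" using s z by (intro continuous_on_subset[OF v'c]) auto
    ultimately obtain x where "s \<le> x" "x \<le> z" "v' x = 0"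
      using IVT2'[of v' z 0 s] ps z by auto
    then show False using v'_nz[of x] s z by auto
  qed
  have v'_eq: "v' s = - (lam * flux N h s)" if s: "s \<in> {0<..<1}" for s
    using power_eq_imp_eq_base[of "- v' s" N "lam * flux N h s"] pow[of s] v'_neg[OF s] flux_pos[OF s] lam N s
    by auto
  have v_eq: "v r + lam * descent N h r = v 0" if "r \<in> {0..1}" for r
  proof -
    have "v r + lam * descent N h r = v 0 + lam * descent N h 0"
    proof (rule DERIV_isconst2[of 0 1])
      show "continuous_on {0..1} (\<lambda>r. v r + lam * descent N h r)"
        by (intro continuous_intros vc continuous_on_descent hc)
      fix x :: real assume "0 < x" "x < 1"
      then have x: "x \<in> {0<..<1}" by simp
      have "(descent N h has_real_derivative flux N h x) (at x)"
        using has_real_derivative_descent[OF hc, of x] x at_within_unit[OF x] by auto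
      from DERIV_add[OF dv[OF x] DERIV_cmult[OF this, of lam]]
      show "((\<lambda>r. v r + lam * descent N h r) has_real_derivative 0) (at x)"
        by (simp add: v'_eq[OF x])
    qed (use that in auto)
    then show ?thesis by simp
  qed
  \<comment> \<open>Positivity is only given in the open interval; at 0 it follows from
    \<open>v 0 \<ge> v (1/2)\<close>.\<close>
  have "0 \<le> lam * descent N h (1/2)" using descent_nonneg[OF N hc h0, of "1/2"] lam by simp
  then have "0 < v 0" using v_eq[of "1/2"] pos[of "1/2"] by simp
  moreover have "v r = lam * (descent N h 1 - descent N h r)" if "r \<in> {0..1}" for r
    using v_eq[OF that] v_eq[of 1] bc(2) by (simp add: algebra_simps)
  ultimately show ?thesis using that[of v] vc nn unfolding h_def by blast
qed

text \<open>By homogeneity the initial height can be fixed at 1, and the shooting parameter is the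
  eigenvalue itself.\<close>

lemma positive_eigenvalue_exists:
  assumes N: "N \<ge> 1"
  obtains lam where "0 < lam" "has_positive_eigenfunction N lam"
proof -
  \<comment> \<open>Clipping makes the nonlinearity nonnegative and bounded, and changes nothing on
    \<open>{0..1}\<close>, where the resulting profile takes its values.\<close>
  define clip :: "real \<Rightarrow> real" where "clip s = min 1 (max 0 s)" for s
  define G where "G p s = p ^ N * clip s ^ N" for p s
  have clip: "0 \<le> clip s" "clip s \<le> 1" for s by (auto simp: clip_def)
  have Gc: "continuous_on ({1/2..17} \<times> UNIV) (\<lambda>(p, s). G p s)"
    unfolding G_def clip_def case_prod_unfold by (intro continuous_intros)
  have G0: "0 \<le> G p s" if "p \<in> {1/2..17}" for p s
    using that clip by (auto simp: G_def)
  have GB: "G p s \<le> p ^ N" if "p \<in> {1/2..17}" for p s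
    using that clip[of s] by (auto simp: G_def intro!: mult_left_le power_le_one)
  have sol: "radial_solution N (G p) v 1" if "p \<in> {1/2..17}" "radial_ivp N (G p) 1 v" for p v
    using that N G0 continuous_on_slice[OF Gc that(1)] by unfold_locales auto
  \<comment> \<open>At parameter \<open>1/2\<close> the flux is at most \<open>1/2\<close>, so
    \<open>v 1\<close> is at least \<open>1/2\<close>; at 17, which exceeds 16, the solution crosses
    zero.\<close>
  obtain p v where p: "p \<in> {1/2..17}" and v: "radial_ivp N (G p) 1 v" "v 1 = 0"
  proof (rule radial_shooting[OF N _ Gc G0, where B = "17 ^ N" and d = "\<lambda>_. 1"])
    show "G p s \<le> 17 ^ N" if "p \<in> {1/2..17}" for p s
      using GB[OF that, of s] power_mono[of p 17 N] that by auto
    fix v :: "real \<Rightarrow> real"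
    assume iv: "radial_ivp N (G (1/2)) 1 v"
    interpret radial_solution N "G (1/2)" v 1 by (rule sol[OF _ iv]) simp
    have "\<bar>descent N src 1 - descent N src 0\<bar> \<le> root N ((1/2) ^ N) * \<bar>1 - 0\<bar>"
      by (rule descent_lipschitz[OF N src_continuous]) (use G0 GB in auto)
    then show "0 < v 1" using v_eq[of 1] N real_root_power_cancel[of N "1/2"] by auto
  next
    fix v :: "real \<Rightarrow> real"
    assume iv: "radial_ivp N (G 17) 1 v"
    interpret radial_solution N "G 17" v 1 by (rule sol[OF _ iv]) simp
    show "v 1 < 0"
      by (rule steep_crosses_zero[of 17]) (auto simp: G_def clip_def power_mult_distrib)
  qed auto
  interpret radial_solution N "G p" v 1 by (rule sol[OF p v(1)])
  obtain v' v'' where P: "radial_profile N (G p) v v' v''"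
    using p by (rule_tac radial_profile_exists[OF _ v(2)]) (auto simp: G_def clip_def)
  have "G p (v r) = p ^ N * v r ^ N" if "r \<in> {0<..<1}" for r
    using P v_le[of r] that by (auto simp: radial_profile_def G_def clip_def)
  then have "has_positive_eigenfunction N p"
    using P unfolding has_positive_eigenfunction_def radial_profile_def
    by (intro exI[of _ v] exI[of _ v'] exI[of _ v'']) (auto simp: mult_ac)
  moreover have "0 < p" using p by simp
  ultimately show ?thesis using that by blast
qed

text \<open>If \<open>mu < lam\<close>, comparison with \<open>phi\<close> would force the
  eigenfunction \<open>psi\<close> to be nonpositive. Exchanging the roles yields
  uniqueness.\<close>

lemma positive_eigenvalue_le:
  assumes N: "N \<ge> 1" and "0 < lam" "has_positive_eigenfunction N lam"
    "0 < mu" "has_positive_eigenfunction N mu"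
  shows "lam \<le> mu"
proof (rule ccontr)
  assume "\<not> lam \<le> mu"
  obtain phi where phi: "continuous_on {0..1} phi" "\<And>r. r \<in> {0..1} \<Longrightarrow> 0 \<le> phi r" "0 < phi 0"
    "\<And>r. r \<in> {0..1} \<Longrightarrow>
      phi r = lam * (descent N (\<lambda>t. phi t ^ N) 1 - descent N (\<lambda>t. phi t ^ N) r)"
    using positive_eigenfunction_integral_form[OF assms(1-3)] by blast
  obtain psi where psi: "continuous_on {0..1} psi" "\<And>r. r \<in> {0..1} \<Longrightarrow> 0 \<le> psi r" "0 < psi 0"
    "\<And>r. r \<in> {0..1} \<Longrightarrow>
      psi r = mu * (descent N (\<lambda>t. psi t ^ N) 1 - descent N (\<lambda>t. psi t ^ N) r)"
    using positive_eigenfunction_integral_form[OF assms(1,4,5)] by blast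
  have "psi 0 \<le> 0"
    by (rule eigenfunction_comparison[OF N _ _ phi psi(1,2) eq_refl[OF psi(4)]])
      (use \<open>\<not> lam \<le> mu\<close> \<open>0 < mu\<close> in auto)
  then show False using psi(3) by simp
qed

lemma first_eigenvalue_positive_eigenfunction:
  assumes "N \<ge> 1"
  shows "0 < first_eigenvalue N \<and> has_positive_eigenfunction N (first_eigenvalue N)"
proof -
  obtain lam where "0 < lam" "has_positive_eigenfunction N lam"
    using positive_eigenvalue_exists[OF assms] by blast
  then have "\<exists>!lam. 0 < lam \<and> has_positive_eigenfunction N lam"
    using positive_eigenvalue_le[OF assms] by (intro ex1I[of _ lam]) (auto intro: antisym)
  then show ?thesis unfolding first_eigenvalue_def by (rule theI')
qed

text \<open>Shooting in the initial height, with \<open>g\<close> only constrained on the positive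
  half-line. This allows it to be applied to \<open>f\<close> and to its reflection.\<close>

lemma superlinear_radial_profile:
  fixes g :: "real \<Rightarrow> real"
  assumes N: "N \<ge> 1" and g: "continuous_on UNIV g" and g_pos: "\<And>s. 0 < s \<Longrightarrow> 0 < g s"
    and f0: "0 < f0" and lim0: "((\<lambda>s. g s / s ^ N) \<longlongrightarrow> f0 ^ N) (at_right 0)"
    and lim_top: "filterlim (\<lambda>s. g s / s ^ N) at_top at_top"
    and lam: "0 < lam" "lam < first_eigenvalue N / f0"
  obtains v v' v'' where "radial_profile N (\<lambda>s. lam ^ N * g s) v v' v''"
proof -
  let ?\<Lambda> = "first_eigenvalue N"
  have "lam * f0 < ?\<Lambda>" using lam f0 by (simp add: field_simps)
  \<comment> \<open>The gap between \<open>lam * f0\<close> and the eigenvalue leaves room for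
    \<open>mu\<close>, which turns the limit at 0 into the inequality \<open>small\<close>.\<close>
  then obtain mu where mu: "lam * f0 < mu" "mu < ?\<Lambda>" using dense by blast
  have mu0: "0 < mu" using mu lam f0 by (meson less_trans mult_pos_pos)
  have "f0 ^ N < (mu / lam) ^ N"
    using mu lam f0 N by (intro power_strict_mono) (auto simp: field_simps)
  from order_tendstoD(2)[OF lim0 this]
  obtain \<delta> where \<delta>: "0 < \<delta>" "\<And>s. 0 < s \<Longrightarrow> s < \<delta> \<Longrightarrow> g s / s ^ N < (mu / lam) ^ N"
    by (auto simp: eventually_at_right_field)
  have small: "lam ^ N * g s \<le> mu ^ N * s ^ N" if "0 < s" "s < \<delta>" for s
    using \<delta>(2)[OF that] that lam by (simp add: power_divide field_simps)
  \<comment> \<open>The factor \<open>17 / lam\<close> is chosen so that \<open>large\<close> meets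
    the steepness threshold 16.\<close>
  from lim_top obtain S where S: "\<And>s. S \<le> s \<Longrightarrow> (17 / lam) ^ N \<le> g s / s ^ N"
    by (auto simp: filterlim_at_top eventually_at_top_linorder)
  have large: "(17 * s) ^ N \<le> lam ^ N * g s" if "0 < s" "S \<le> s" for s
    using S[OF that(2)] that lam by (simp add: power_divide power_mult_distrib field_simps)
  define a where "a = \<delta> / 2"
  \<comment> \<open>Since \<open>b / 2\<close> is at least \<open>S\<close>, the bound
    \<open>large\<close> holds on all of \<open>{b / 2..b}\<close>.\<close>
  define b where "b = max a (2 * S)"
  have ab: "0 < a" "a < \<delta>" "a \<le> b" "2 * S \<le> b" using \<delta> by (auto simp: a_def b_def)
  \<comment> \<open>A finite limit of \<open>g s / s ^ N\<close> forces \<open>g\<close> to vanish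
    at 0, so the source is zero wherever a solution is negative.\<close>
  have g0: "g 0 = 0"
  proof -
    have "(g \<longlongrightarrow> g 0) (at_right 0)"
      using g by (auto simp: continuous_on_def intro: tendsto_mono at_le)
    moreover have "((\<lambda>s. g s / s ^ N * s ^ N) \<longlongrightarrow> f0 ^ N * 0 ^ N) (at_right 0)"
      by (intro tendsto_intros lim0)
    then have "(g \<longlongrightarrow> f0 ^ N * 0 ^ N) (at_right 0)"
      by (rule Lim_transform_eventually) (auto simp: eventually_at_filter)
    ultimately have "g 0 = f0 ^ N * 0 ^ N" by (intro tendsto_unique[of "at_right 0"]) auto
    then show ?thesis using N by (simp add: zero_power)
  qed
  have g_nonneg: "0 \<le> g s" if "0 \<le> s" for s
    using g_pos[of s] g0 that by (cases "s = 0") auto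
  \<comment> \<open>Truncation gives the bounded nonnegative source that shooting requires. It does
    not affect nonnegative solutions starting at height at most \<open>b\<close>.\<close>
  define G where "G s = lam ^ N * g (min b (max 0 s))" for s
  have Gc: "continuous_on UNIV G"
    unfolding G_def by (intro continuous_intros continuous_on_compose2[OF g]) auto
  have G0: "0 \<le> G s" for s
    using g_nonneg[of "min b (max 0 s)"] lam ab by (simp add: G_def)
  have G_eq: "G s = lam ^ N * g s" if "0 \<le> s" "s \<le> b" for s using that by (simp add: G_def)
  have "\<exists>B. \<forall>x\<in>{0..b}. norm (g x) \<le> B"
    using compact_imp_bounded[OF compact_continuous_image[OF continuous_on_subset[OF g] compact_Icc]]
    unfolding bounded_iff by blast
  then obtain B where "\<And>x. x \<in> {0..b} \<Longrightarrow> g x \<le> B" by (metis abs_le_D1 real_norm_def)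
  then have GB: "G s \<le> lam ^ N * B" for s
    using lam ab by (auto simp: G_def intro!: mult_left_mono)
  have sol: "radial_solution N G v d" if "radial_ivp N G d v" for v d
    using that N Gc G0 by unfold_locales auto
  obtain p v where p: "p \<in> {a..b}" and v: "radial_ivp N G p v" "v 1 = 0"
  proof (rule radial_shooting[OF N ab(3), where G = "\<lambda>_. G" and d = "\<lambda>p. p" and B = "lam ^ N * B"])
    show "continuous_on ({a..b} \<times> UNIV) (\<lambda>(p, s). G s)"
      unfolding case_prod_unfold by (intro continuous_on_compose2[OF Gc] continuous_intros) auto
    fix v :: "real \<Rightarrow> real"
    assume iv: "radial_ivp N G a v"
    interpret radial_solution N G v a by (rule sol[OF iv])
    show "0 < v 1"
    proof (rule ccontr)
      assume v1: "\<not> 0 < v 1"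
      obtain phi where phi: "continuous_on {0..1} phi" "\<And>r. r \<in> {0..1} \<Longrightarrow> 0 \<le> phi r" "0 < phi 0"
        "\<And>r. r \<in> {0..1} \<Longrightarrow>
          phi r = ?\<Lambda> * (descent N (\<lambda>t. phi t ^ N) 1 - descent N (\<lambda>t. phi t ^ N) r)"
        using positive_eigenfunction_integral_form[OF N] first_eigenvalue_positive_eigenfunction[OF N]
        by blast
      \<comment> \<open>The solution may become negative, so the comparison is made with its
        positive part. As \<open>v 1\<close> is nonpositive, \<open>v r\<close> is at most the
        integral of the flux over \<open>{r..1}\<close>; as \<open>v\<close> stays below
        \<open>a < \<delta>\<close>, that flux is at most \<open>mu\<close> times the flux for
        \<open>w ^ N\<close>.\<close>
      define w where "w r = max 0 (v r)" for r
      have wc: "continuous_on {0..1} w" unfolding w_def by (intro continuous_intros v_continuous)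
      have wNc: "continuous_on {0..1} (\<lambda>t. w t ^ N)" by (intro continuous_intros wc)
      have src_le: "src t \<le> mu ^ N * w t ^ N" if "t \<in> {0..1}" for t
      proof (cases "v t \<le> 0")
        case True
        then show ?thesis using ab g0 mu0 by (simp add: G_def w_def min_def max_def)
      next
        case False
        then show ?thesis using small[of "v t"] G_eq[of "v t"] v_le[OF that] ab by (simp add: w_def)
      qed
      have "w r \<le> mu * (descent N (\<lambda>t. w t ^ N) 1 - descent N (\<lambda>t. w t ^ N) r)" if r: "r \<in> {0..1}" for r
      proof -
        have int: "flux N k integrable_on {r..1}" if "continuous_on {0..1} k" for k
          using r by (intro integrable_continuous_real continuous_on_subset[OF continuous_on_flux[OF that]]) auto
        have "flux N src s \<le> mu * flux N (\<lambda>t. w t ^ N) s" if "s \<in> {r..1}" for s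
          using that r mu0 src_le
          by (subst flux_cmult_power[OF N, symmetric])
            (auto intro!: flux_mono_fun N[unfolded One_nat_def] src_continuous continuous_intros wc)
        then have "integral {r..1} (flux N src) \<le> integral {r..1} (\<lambda>s. mu * flux N (\<lambda>t. w t ^ N) s)"
          by (intro integral_le int src_continuous integrable_on_mult_right wNc)
        moreover have "0 \<le> integral {r..1} (flux N src)"
          using r by (intro integral_nonneg int src_continuous flux_nonneg N G_nonneg) auto
        moreover have "v r - v 1 = integral {r..1} (flux N src)"
          using descent_diff[OF src_continuous r, of N] v_eq[OF r] v_eq[of 1] by simp
        ultimately show ?thesis
          using v1 descent_diff[OF wNc r, of N] by (simp add: w_def)
      qed
      then have "w 0 \<le> 0"
        by (intro eigenfunction_comparison[OF N _ mu(2) phi wc]) (use mu0 in \<open>auto simp: w_def\<close>)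
      then show False using ab by (simp add: w_def)
    qed
  next
    fix v :: "real \<Rightarrow> real"
    assume iv: "radial_ivp N G b v"
    interpret radial_solution N G v b by (rule sol[OF iv])
    show "v 1 < 0"
    proof (rule steep_crosses_zero[of 17])
      show "(17 * s) ^ N \<le> G s" if "s \<in> {b / 2..b}" for s
        using large[of s] G_eq[of s] that ab by auto
    qed (use ab in auto)
  qed (use G0 GB in \<open>auto intro: continuous_intros\<close>)
  interpret radial_solution N G v p by (rule sol[OF v(1)])
  obtain v' v'' where P: "radial_profile N G v v' v''"
  proof (rule radial_profile_exists[OF _ v(2)])
    show "0 < G s" if "s \<in> {0<..p}" for s
      using g_pos[of s] G_eq[of s] that p lam by auto
  qed (use p ab in auto)
  have "G (v r) = lam ^ N * g (v r)" if "r \<in> {0<..<1}" for r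
    using P v_le[of r] p that by (intro G_eq) (auto simp: radial_profile_def intro: less_imp_le)
  then have "radial_profile N (\<lambda>s. lam ^ N * g s) v v' v''"
    using P unfolding radial_profile_def by auto
  then show ?thesis by (rule that)
qed

section \<open>From profiles to the negative and the positive solution\<close>

theorem theorem4p3:
  fixes N :: nat and f :: "real \<Rightarrow> real" and f0 lam :: real
  assumes N: "N \<ge> 1"
    and f_cont: "continuous_on UNIV f"
    and f1: "\<forall>s. s \<noteq> 0 \<longrightarrow> f s * s ^ N > 0"
    and f0_pos: "0 < f0"
    and f0_lim: "((\<lambda>s. f s / s ^ N) \<longlongrightarrow> f0 ^ N) (at 0)"
    and finf_lim: "filterlim (\<lambda>s. f s / s ^ N) at_top at_infinity"
    and lam_pos: "0 < lam"
    and lam_bound: "lam < first_eigenvalue N / f0"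
  shows "\<exists>up um.
           MO_solution N f lam up \<and> (\<forall>r\<in>{0<..<1}. up r > 0) \<and>
             strictly_concave_on {0<..<1} up \<and>
           MO_solution N f lam um \<and> (\<forall>r\<in>{0<..<1}. um r < 0) \<and>
             strictly_convex_on {0<..<1} um"
proof -
  obtain v v' v'' where v: "radial_profile N (\<lambda>s. lam ^ N * f s) v v' v''"
  proof (rule superlinear_radial_profile[OF N f_cont _ f0_pos _ _ lam_pos lam_bound])
    show "0 < f s" if "0 < s" for s
      using spec[OF f1, of s] that by (simp add: zero_less_mult_iff)
    show "((\<lambda>s. f s / s ^ N) \<longlongrightarrow> f0 ^ N) (at_right 0)"
      by (rule tendsto_within_subset[OF f0_lim]) simp
    show "filterlim (\<lambda>s. f s / s ^ N) at_top at_top"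
      by (rule filterlim_mono[OF finf_lim order_refl at_top_le_at_infinity])
  qed
  \<comment> \<open>The reflected nonlinearity, with the sign that makes \<open>g s / s ^ N\<close>
    equal to the ratio of \<open>f\<close> at \<open>- s\<close>. Condition (f1) and the two-sided
    limits thus carry over to \<open>g\<close> on the positive half-line.\<close>
  define g where "g s = (- 1) ^ N * f (- s)" for s
  have g_ratio: "(\<lambda>s. g s / s ^ N) = (\<lambda>s. f (- s) / (- s) ^ N)"
  proof
    fix s show "g s / s ^ N = f (- s) / (- s) ^ N"
      by (cases "even N") (simp_all add: g_def)
  qed
  obtain w w' w'' where w: "radial_profile N (\<lambda>s. lam ^ N * g s) w w' w''"
  proof (rule superlinear_radial_profile[OF N _ _ f0_pos _ _ lam_pos lam_bound])
    show "continuous_on UNIV g"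
      unfolding g_def by (intro continuous_intros continuous_on_compose2[OF f_cont]) auto
    show "0 < g s" if "0 < s" for s
    proof -
      have "0 < f (- s) * (- s) ^ N" using f1 that by simp
      also have "\<dots> = g s * s ^ N" by (cases "even N") (simp_all add: g_def)
      finally show ?thesis using that by (simp add: zero_less_mult_iff)
    qed
    have "filterlim uminus (at 0) (at_right (0::real))"
      by (auto simp: filterlim_at eventually_at_filter intro!: tendsto_eq_intros)
    from filterlim_compose[OF f0_lim this]
    show "((\<lambda>s. g s / s ^ N) \<longlongrightarrow> f0 ^ N) (at_right 0)" unfolding g_ratio .
    have "filterlim uminus at_infinity (at_top :: real filter)"
      by (rule filterlim_mono[OF filterlim_uminus_at_bot_at_top at_bot_le_at_infinity order_refl])
    from filterlim_compose[OF finf_lim this]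
    show "filterlim (\<lambda>s. g s / s ^ N) at_top at_top" unfolding g_ratio .
  qed
  have "MO_solution N f lam w"
    unfolding MO_solution_def
  proof (intro exI conjI ballI)
    show "C2_01 w w' w''" "w' 0 = 0" "w 1 = 0" using w by (auto simp: radial_profile_def)
    fix r :: real assume "r \<in> {0<..<1}"
    \<comment> \<open>Multiplication by \<open>(- 1) ^ N\<close> turns \<open>(- w')^N\<close> into
      \<open>w'^N\<close> and cancels the sign in \<open>g\<close>, leaving
      \<open>f (- w r)\<close>.\<close>
    then have "((\<lambda>s. (- 1) ^ N * (- w' s) ^ N) has_real_derivative
        (- 1) ^ N * (real N * r ^ (N - 1) * (lam ^ N * g (w r)))) (at r)"
      using w unfolding radial_profile_def by (intro DERIV_cmult) auto
    moreover have "(- 1) ^ N * (- w' s) ^ N = w' s ^ N" for s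
      by (simp flip: power_mult_distrib)
    moreover have "(- 1) ^ N * g s = f (- s)" for s
      by (cases "even N") (simp_all add: g_def)
    moreover have "(- 1) ^ N * (real N * r ^ (N - 1) * (lam ^ N * g (w r)))
        = lam ^ N * real N * r ^ (N - 1) * ((- 1) ^ N * g (w r))"
      by (simp add: mult_ac)
    ultimately show "((\<lambda>s. w' s ^ N) has_real_derivative
        lam ^ N * real N * r ^ (N - 1) * f (- w r)) (at r)"
      by (simp only:)
  qed
  \<comment> \<open>For \<open>u = - v\<close> one has \<open>u' = - v'\<close> and
    \<open>f (- u) = f v\<close>, so the profile equation is already the required one.\<close>
  moreover have "MO_solution N f lam (\<lambda>r. - v r)"
    unfolding MO_solution_def
  proof (intro exI conjI ballI)
    show "C2_01 (\<lambda>r. - v r) (\<lambda>r. - v' r) (\<lambda>r. - v'' r)"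
      using v by (auto simp: radial_profile_def C2_01_def intro!: DERIV_minus continuous_intros)
    show "- v' 0 = 0" "- v 1 = 0" using v by (auto simp: radial_profile_def)
    fix r :: real assume "r \<in> {0<..<1}"
    then show "((\<lambda>s. (- v' s) ^ N) has_real_derivative
        lam ^ N * real N * r ^ (N - 1) * f (- (- v r))) (at r)"
      using v unfolding radial_profile_def by (auto simp: mult_ac)
  qed
  moreover have "strictly_convex_on {0<..<1} (\<lambda>r. - v r)"
    using v by (fastforce simp: radial_profile_def strictly_concave_on_def strictly_convex_on_def)
  ultimately show ?thesis
    using v w unfolding radial_profile_def
    by (intro exI[of _ w] exI[of _ "\<lambda>r. - v r"]) auto
qed

end
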